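(* The sequence of processes $\{X_{2n+1}\}_{n=1}^\infty$ is tight, as a sequence of $C[0,\infty)$-valued random variables.
   Context: Let $\{B_j(t)\}_{j=1}^\infty$ be a sequence of independent, standard, one-dimensional Brownian motions (started at the origin). Define the median function $\mathcal{M}_n:\mathbb{R}^n\to\mathbb{R}$ as follows: if $(x_1,\ldots,x_n)\in\mathbb{R}^n$ and $\tau$ is a permutation of $\{1,\ldots,n\}$ with $x_{\tau(1)}\le\cdots\le x_{\tau(n)}$, then $\mathcal{M}_n(x_1,\ldots,x_n)=x_{\tau(k)}$, where $k=\lfloor (n+1)/2\rfloor$. Define the (continuous) median process $M_n(t)=\mathcal{M}_n(B_1(t),\ldots,B_n(t))$ and the scaled median process $X_n(t)=\sqrt{n}\,M_n(t)$, $0\le t<\infty$. The random variables $X_n$ take values in $C[0,\infty)$, endowed with the topology of uniform convergence on compact sets. *)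

theory Defs
  imports "HOL-Probability.Probability"
begin

section \<open>The space of continuous functions on the half-line\<close>

text \<open>
  The type \<open>cpath\<close> is C[0,\<open>\<infinity>\<close>). Its elements are represented by functions on all reals, so
  extensionality on \<open>{0..}\<close> is required to make the representation of each function unique.
\<close>

typedef cpath = "{f :: real \<Rightarrow> real. continuous_on {0..} f \<and> f \<in> extensional {0..}}"
  morphisms path_at Abs_cpath
proof
  show "restrict (\<lambda>_. 0) {0..} \<in> {f :: real \<Rightarrow> real. continuous_on {0..} f \<and> f \<in> extensional {0..}}"
    by (auto intro!: continuous_on_eq[OF continuous_on_const[of _ 0]])
qed

definition cpath_of :: "(real \<Rightarrow> real) \<Rightarrow> cpath" where
  "cpath_of f = Abs_cpath (restrict f {0..})"

lemma path_at_cpath_of: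
  assumes "continuous_on {0..} f" "t \<ge> 0"
  shows "path_at (cpath_of f) t = f t"
proof -
  have "continuous_on {0..} (restrict f {0..})"
    by (rule continuous_on_eq[OF assms(1)]) auto
  then show ?thesis
    using assms(2) unfolding cpath_of_def by (subst Abs_cpath_inverse) auto
qed

lemma continuous_on_path_at: "S \<subseteq> {0..} \<Longrightarrow> continuous_on S (path_at f)"
  using path_at[of f] continuous_on_subset by blast

lemma cpath_eqI:
  assumes "\<And>t. t \<ge> 0 \<Longrightarrow> path_at f t = path_at g t"
  shows "f = g"
proof -
  have "path_at f = path_at g"
    using assms path_at[of f] path_at[of g] by (intro extensionalityI[of _ "{0..}"]) auto
  then show ?thesis by (simp add: path_at_inject)
qed

text \<open>
  The topology of uniform convergence on compact sets. Lemma \<open>tendsto_cpath_iff\<close> below confirms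
  that its convergence is uniform convergence on every compact subset of \<open>{0..}\<close>.
\<close>

instantiation cpath :: t2_space
begin

definition open_cpath :: "cpath set \<Rightarrow> bool" where
  "open_cpath U \<longleftrightarrow> (\<forall>f\<in>U. \<exists>K e. compact K \<and> K \<subseteq> {0..} \<and> e > 0 \<and>
     {g. \<forall>t\<in>K. dist (path_at g t) (path_at f t) < e} \<subseteq> U)"

lemma open_cpath_nbhd:
  assumes K: "compact K" "K \<subseteq> {0..}"
  shows "open {g. \<forall>t\<in>K. dist (path_at g t) (path_at f t) < e}"
proof (unfold open_cpath_def, rule ballI)
  fix g assume g: "g \<in> {g. \<forall>t\<in>K. dist (path_at g t) (path_at f t) < e}"
  have "\<exists>d>0. \<forall>t\<in>K. dist (path_at g t) (path_at f t) + d \<le> e"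
  proof (cases "K = {}")
    case True
    then show ?thesis by (auto intro: exI[of _ 1])
  next
    case False
    have "continuous_on K (\<lambda>t. dist (path_at g t) (path_at f t))"
      by (intro continuous_intros continuous_on_path_at K)
    from continuous_attains_sup[OF K(1) False this] obtain s where
      s: "s \<in> K" "\<forall>t\<in>K. dist (path_at g t) (path_at f t) \<le> dist (path_at g s) (path_at f s)"
      by blast
    show ?thesis
      using g s by (intro exI[of _ "e - dist (path_at g s) (path_at f s)"]) auto
  qed
  then obtain d where d: "d > 0" "\<forall>t\<in>K. dist (path_at g t) (path_at f t) + d \<le> e" by blast
  have "dist (path_at h t) (path_at f t) < e"
    if "t \<in> K" "dist (path_at h t) (path_at g t) < d" for h t
    using dist_triangle[of "path_at h t" "path_at f t" "path_at g t"] d(2) that by force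
  then have "{h. \<forall>t\<in>K. dist (path_at h t) (path_at g t) < d}
      \<subseteq> {g. \<forall>t\<in>K. dist (path_at g t) (path_at f t) < e}"
    by blast
  then show "\<exists>L d. compact L \<and> L \<subseteq> {0..} \<and> d > 0 \<and>
      {h. \<forall>t\<in>L. dist (path_at h t) (path_at g t) < d}
      \<subseteq> {g. \<forall>t\<in>K. dist (path_at g t) (path_at f t) < e}"
    using K d(1) by blast
qed

instance
proof
  show "open (UNIV :: cpath set)"
    unfolding open_cpath_def by (intro ballI exI[of _ "{}"] exI[of _ "1 :: real"]) auto
next
  fix S T :: "cpath set"
  assume S: "open S" and T: "open T"
  show "open (S \<inter> T)"
    unfolding open_cpath_def
  proof
    fix f assume "f \<in> S \<inter> T"
    then have f: "f \<in> S" "f \<in> T" by auto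
    obtain K e where K: "compact K" "K \<subseteq> {0..}" "e > 0"
      "{g. \<forall>t\<in>K. dist (path_at g t) (path_at f t) < e} \<subseteq> S"
      using S[unfolded open_cpath_def, rule_format, OF f(1)] by blast
    obtain L d where L: "compact L" "L \<subseteq> {0..}" "d > 0"
      "{g. \<forall>t\<in>L. dist (path_at g t) (path_at f t) < d} \<subseteq> T"
      using T[unfolded open_cpath_def, rule_format, OF f(2)] by blast
    have "{g. \<forall>t\<in>K \<union> L. dist (path_at g t) (path_at f t) < min e d} \<subseteq> S \<inter> T"
      using K(4) L(4) by fastforce
    then show "\<exists>K e. compact K \<and> K \<subseteq> {0..} \<and> e > 0 \<and>
        {g. \<forall>t\<in>K. dist (path_at g t) (path_at f t) < e} \<subseteq> S \<inter> T"
      using K L by (intro exI[of _ "K \<union> L"] exI[of _ "min e d"] conjI) (auto intro: compact_Un)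
  qed
next
  fix \<U> :: "cpath set set"
  assume U: "\<forall>S\<in>\<U>. open S"
  show "open (\<Union> \<U>)"
    unfolding open_cpath_def
  proof
    fix f assume "f \<in> \<Union> \<U>"
    then obtain S where S: "S \<in> \<U>" "f \<in> S" by blast
    with U have "open S" by blast
    from this[unfolded open_cpath_def, rule_format, OF S(2)] S(1)
    show "\<exists>K e. compact K \<and> K \<subseteq> {0..} \<and> e > 0 \<and>
        {g. \<forall>t\<in>K. dist (path_at g t) (path_at f t) < e} \<subseteq> \<Union> \<U>"
      by (meson Union_upper order_trans)
  qed
next
  fix f g :: cpath
  assume "f \<noteq> g"
  then obtain t where t: "t \<ge> 0" "path_at f t \<noteq> path_at g t" using cpath_eqI by blast
  define e where "e = dist (path_at f t) (path_at g t) / 2"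
  have e: "e > 0" using t by (simp add: e_def)
  define U where "U h = {k. \<forall>s\<in>{t}. dist (path_at k s) (path_at h s) < e}" for h
  have "open (U h)" for h
    unfolding U_def using t by (intro open_cpath_nbhd) auto
  moreover have "f \<in> U f" "g \<in> U g" using e by (auto simp: U_def)
  moreover have "U f \<inter> U g = {}"
    by (auto simp: U_def e_def dist_real_def abs_if field_simps split: if_splits)
  ultimately show "\<exists>U V. open U \<and> open V \<and> f \<in> U \<and> g \<in> V \<and> U \<inter> V = {}" by blast
qed

end

lemma tendsto_cpath_iff:
  fixes f :: cpath
  shows "(X \<longlongrightarrow> f) F \<longleftrightarrow>
    (\<forall>K. compact K \<and> K \<subseteq> {0..} \<longrightarrow> uniform_limit K (\<lambda>n. path_at (X n)) (path_at f) F)"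
proof
  assume L: "(X \<longlongrightarrow> f) F"
  show "\<forall>K. compact K \<and> K \<subseteq> {0..} \<longrightarrow> uniform_limit K (\<lambda>n. path_at (X n)) (path_at f) F"
  proof (intro allI impI uniform_limitI)
    fix K :: "real set" and e :: real
    assume K: "compact K \<and> K \<subseteq> {0..}" and e: "e > 0"
    have "open {g. \<forall>t\<in>K. dist (path_at g t) (path_at f t) < e}"
      using K by (intro open_cpath_nbhd) auto
    from topological_tendstoD[OF L this] e
    show "\<forall>\<^sub>F n in F. \<forall>t\<in>K. dist (path_at (X n) t) (path_at f t) < e" by simp
  qed
next
  assume U: "\<forall>K. compact K \<and> K \<subseteq> {0..} \<longrightarrow> uniform_limit K (\<lambda>n. path_at (X n)) (path_at f) F"
  show "(X \<longlongrightarrow> f) F"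
  proof (rule topological_tendstoI)
    fix S :: "cpath set" assume S: "open S" "f \<in> S"
    obtain K e where K: "compact K" "K \<subseteq> {0..}" "e > 0"
      "{g. \<forall>t\<in>K. dist (path_at g t) (path_at f t) < e} \<subseteq> S"
      using S(1)[unfolded open_cpath_def, rule_format, OF S(2)] by blast
    have "uniform_limit K (\<lambda>n. path_at (X n)) (path_at f) F"
      using U K(1,2) by blast
    from uniform_limitD[OF this K(3)] have "\<forall>\<^sub>F n in F. \<forall>t\<in>K. dist (path_at (X n) t) (path_at f t) < e" .
    then show "\<forall>\<^sub>F n in F. X n \<in> S" by eventually_elim (use K in auto)
  qed
qed

section \<open>Tightness\<close>

text \<open>
  The library only has the constant \<open>tight\<close>, for sequences of laws on the reals. Here the laws live
  on the Borel sets of a Hausdorff space, in which compact sets are Borel.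
\<close>

definition tight_laws :: "'i set \<Rightarrow> ('i \<Rightarrow> 'b::t2_space measure) \<Rightarrow> bool" where
  "tight_laws I \<mu> \<longleftrightarrow> (\<forall>i\<in>I. prob_space (\<mu> i) \<and> sets (\<mu> i) = sets borel) \<and>
     (\<forall>\<epsilon>::real>0. \<exists>K. compact K \<and> (\<forall>i\<in>I. measure (\<mu> i) K > 1 - \<epsilon>))"

definition tight_random_variables ::
    "'a measure \<Rightarrow> 'i set \<Rightarrow> ('i \<Rightarrow> 'a \<Rightarrow> 'b::t2_space) \<Rightarrow> bool" where
  "tight_random_variables M I X \<longleftrightarrow>
     (\<forall>i\<in>I. X i \<in> borel_measurable M) \<and> tight_laws I (\<lambda>i. distr M borel (X i))"

section \<open>Brownian motion\<close>

definition standard_brownian_motion :: "'a measure \<Rightarrow> (real \<Rightarrow> 'a \<Rightarrow> real) \<Rightarrow> bool" where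
  "standard_brownian_motion M W \<longleftrightarrow>
     (\<forall>t\<ge>0. W t \<in> borel_measurable M) \<and>
     (AE \<omega> in M. W 0 \<omega> = 0) \<and>
     (\<forall>\<omega>\<in>space M. continuous_on {0..} (\<lambda>t. W t \<omega>)) \<and>
     (\<forall>s t. 0 \<le> s \<and> s < t \<longrightarrow>
        distributed M lborel (\<lambda>\<omega>. W t \<omega> - W s \<omega>) (normal_density 0 (sqrt (t - s)))) \<and>
     (\<forall>(m::nat) (t::nat \<Rightarrow> real). 0 \<le> t 0 \<and> (\<forall>i<m. t i \<le> t (Suc i)) \<longrightarrow>
        prob_space.indep_vars M (\<lambda>_. borel) (\<lambda>i \<omega>. W (t (Suc i)) \<omega> - W (t i) \<omega>) {..<m})"

text \<open>
  Independence of the processes as a whole: each is viewed as one random element of the product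
  space of real functions on \<open>{0..}\<close>.
\<close>

definition independent_processes ::
    "'a measure \<Rightarrow> 'i set \<Rightarrow> ('i \<Rightarrow> real \<Rightarrow> 'a \<Rightarrow> real) \<Rightarrow> bool" where
  "independent_processes M I B \<longleftrightarrow>
     prob_space.indep_vars M (\<lambda>_. \<Pi>\<^sub>M t\<in>{0..}. borel) (\<lambda>j \<omega>. \<lambda>t\<in>{0..}. B j t \<omega>) I"

section \<open>The median process\<close>

definition sorting_permutation :: "nat \<Rightarrow> (nat \<Rightarrow> real) \<Rightarrow> (nat \<Rightarrow> nat) \<Rightarrow> bool" where
  "sorting_permutation n x \<tau> \<longleftrightarrow>
     \<tau> permutes {1..n} \<and> (\<forall>i j. 1 \<le> i \<and> i \<le> j \<and> j \<le> n \<longrightarrow> x (\<tau> i) \<le> x (\<tau> j))"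

text \<open>
  A point of \<open>\<real>\<^sup>n\<close> is a function of which only the values at \<open>1, \<dots>, n\<close> matter. The lemmas
  \<open>sorting_permutation_exists\<close> and \<open>median_eq\<close> show that the median is well defined.
\<close>

definition median :: "nat \<Rightarrow> (nat \<Rightarrow> real) \<Rightarrow> real" where
  "median n x = (THE m. \<exists>\<tau>. sorting_permutation n x \<tau> \<and> m = x (\<tau> ((n + 1) div 2)))"

definition median_process :: "(nat \<Rightarrow> real \<Rightarrow> 'a \<Rightarrow> real) \<Rightarrow> nat \<Rightarrow> real \<Rightarrow> 'a \<Rightarrow> real" where
  "median_process B n t \<omega> = median n (\<lambda>j. B j t \<omega>)"

text \<open>
  By \<open>path_at_scaled_median_process\<close>, the use of \<open>cpath_of\<close> is legitimate for processes with
  continuous paths.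
\<close>

definition scaled_median_process :: "(nat \<Rightarrow> real \<Rightarrow> 'a \<Rightarrow> real) \<Rightarrow> nat \<Rightarrow> 'a \<Rightarrow> cpath" where
  "scaled_median_process B n \<omega> = cpath_of (\<lambda>t. sqrt (real n) * median_process B n t \<omega>)"

lemma sorting_permutation_exists: "\<exists>\<tau>. sorting_permutation n x \<tau>"
proof -
  define L where "L = sort_key x [1..<Suc n]"
  have len: "length L = n" and dist: "distinct L" and set: "set L = {1..n}"
    and srt: "sorted (map x L)"
    by (auto simp: L_def)
  define \<tau> where "\<tau> i = (if i \<in> {1..n} then L ! (i - 1) else i)" for i
  have "bij_betw ((!) L) {..<n} {1..n}"
    using bij_betw_nth[OF dist] len set by simp
  moreover have "bij_betw (\<lambda>i. i - 1) {1..n} {..<n}"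
    by (rule bij_betw_byWitness[where f' = Suc]) auto
  ultimately have "bij_betw ((!) L \<circ> (\<lambda>i. i - 1)) {1..n} {1..n}"
    by (rule bij_betw_trans[rotated])
  then have "bij_betw \<tau> {1..n} {1..n}"
    by (subst bij_betw_cong[where g = "(!) L \<circ> (\<lambda>i. i - 1)"]) (auto simp: \<tau>_def)
  then have "\<tau> permutes {1..n}"
    by (rule bij_imp_permutes) (simp only: \<tau>_def if_False)
  moreover have "x (\<tau> i) \<le> x (\<tau> j)" if "1 \<le> i" "i \<le> j" "j \<le> n" for i j
    using sorted_nth_mono[OF srt, of "i - 1" "j - 1"] that len by (simp add: \<tau>_def)
  ultimately show ?thesis unfolding sorting_permutation_def by blast
qed

lemma order_statistic_mono:
  assumes x: "sorting_permutation n x \<tau>" and y: "sorting_permutation n y \<sigma>"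
    and xy: "\<And>i. i \<in> {1..n} \<Longrightarrow> x i \<le> y i + e" and k: "1 \<le> k" "k \<le> n"
  shows "x (\<tau> k) \<le> y (\<sigma> k) + e"
proof (rule ccontr)
  assume "\<not> ?thesis"
  then have less: "y (\<sigma> k) + e < x (\<tau> k)" by simp
  have \<tau>: "\<tau> permutes {1..n}" and \<sigma>: "\<sigma> permutes {1..n}"
    using x y by (auto simp: sorting_permutation_def)
  have "\<sigma> ` {1..k} \<subseteq> \<tau> ` {1..<k}"
  proof
    fix a assume "a \<in> \<sigma> ` {1..k}"
    then obtain i where i: "a = \<sigma> i" "1 \<le> i" "i \<le> k" by auto
    then have a: "a \<in> {1..n}" using permutes_in_image[OF \<sigma>, of i] k by auto
    have "y a \<le> y (\<sigma> k)" using y i k by (simp add: sorting_permutation_def)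
    with xy[OF a] less have "x a < x (\<tau> k)" by linarith
    moreover obtain j where j: "j \<in> {1..n}" "a = \<tau> j"
      using a permutes_image[OF \<tau>] by blast
    ultimately have "j < k"
      using x k by (force simp: sorting_permutation_def not_less[symmetric])
    then show "a \<in> \<tau> ` {1..<k}" using j by auto
  qed
  then have "card (\<sigma> ` {1..k}) \<le> card (\<tau> ` {1..<k})" by (intro card_mono) auto
  moreover have "card (\<sigma> ` {1..k}) = k"
    using permutes_inj[OF \<sigma>] by (subst card_image) (auto intro: inj_on_subset)
  moreover have "card (\<tau> ` {1..<k}) \<le> k - 1"
    using card_image_le[of "{1..<k}" \<tau>] by simp
  ultimately show False using k by simp
qed

lemma median_eq:
  assumes "sorting_permutation n x \<tau>" "n \<ge> 1"
  shows "median n x = x (\<tau> ((n + 1) div 2))"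
  unfolding median_def
proof (rule the_equality)
  fix m assume "\<exists>\<sigma>. sorting_permutation n x \<sigma> \<and> m = x (\<sigma> ((n + 1) div 2))"
  then obtain \<sigma> where s: "sorting_permutation n x \<sigma>" "m = x (\<sigma> ((n + 1) div 2))" by blast
  have "1 \<le> (n + 1) div 2" "(n + 1) div 2 \<le> n" using assms(2) by auto
  then show "m = x (\<tau> ((n + 1) div 2))"
    using order_statistic_mono[OF s(1) assms(1), of 0] order_statistic_mono[OF assms(1) s(1), of 0]
      s(2) by (simp add: order_antisym)
qed (use assms in blast)

lemma median_diff_le:
  assumes n: "n \<ge> 1" and xy: "\<And>i. i \<in> {1..n} \<Longrightarrow> \<bar>x i - y i\<bar> \<le> e"
  shows "\<bar>median n x - median n y\<bar> \<le> e"
proof -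
  obtain \<tau> \<sigma> where s: "sorting_permutation n x \<tau>" "sorting_permutation n y \<sigma>"
    using sorting_permutation_exists by meson
  have k: "1 \<le> (n + 1) div 2" "(n + 1) div 2 \<le> n" using n by auto
  have "x i \<le> y i + e" "y i \<le> x i + e" if "i \<in> {1..n}" for i
    using xy[OF that] by linarith+
  from order_statistic_mono[OF s this(1) k] order_statistic_mono[OF s(2,1) this(2) k]
  show ?thesis using median_eq[OF s(1) n] median_eq[OF s(2) n] by simp
qed

lemma continuous_on_median:
  assumes n: "n \<ge> 1" and f: "\<And>j. j \<in> {1..n} \<Longrightarrow> continuous_on S (f j)"
  shows "continuous_on S (\<lambda>t. median n (\<lambda>j. f j t))"
proof (unfold continuous_on_def, intro ballI tendstoI)
  fix t and e :: real assume t: "t \<in> S" and e: "e > 0"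
  have "\<forall>\<^sub>F s in at t within S. \<forall>j\<in>{1..n}. dist (f j s) (f j t) < e / 2"
    using f t e by (intro eventually_ball_finite ballI tendstoD) (auto simp: continuous_on_def)
  then show "\<forall>\<^sub>F s in at t within S. dist (median n (\<lambda>j. f j s)) (median n (\<lambda>j. f j t)) < e"
  proof eventually_elim
    case (elim s)
    then have "\<bar>median n (\<lambda>j. f j s) - median n (\<lambda>j. f j t)\<bar> \<le> e / 2"
      by (intro median_diff_le n) (auto simp: dist_real_def intro: less_imp_le)
    then show ?case using e by (simp add: dist_real_def)
  qed
qed

lemma path_at_scaled_median_process:
  assumes "n \<ge> 1" "\<And>j. j \<in> {1..n} \<Longrightarrow> continuous_on {0..} (\<lambda>t. B j t \<omega>)" "t \<ge> 0"
  shows "path_at (scaled_median_process B n \<omega>) t = sqrt (real n) * median_process B n t \<omega>"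
  unfolding scaled_median_process_def median_process_def
  using assms by (intro path_at_cpath_of continuous_intros continuous_on_median)

end

theory Submission
  imports Defs
begin

text \<open>
  Write \<open>n = 2 k + 1\<close>, let \<open>m\<close> be a dyadic level and put \<open>q = 2\<^sup>m\<^sup>/\<^sup>1\<^sup>6\<close>. The heart of the matter is that an
  increment of the scaled median over a dyadic interval of length \<open>\<delta> = 1 / q\<^sup>1\<^sup>6\<close> exceeds \<open>2 / q\<close> with
  probability at most a polynomial in \<open>q\<close> times \<open>exp (- c q\<^sup>2)\<close>, uniformly in \<open>n\<close>.
  Such an increment makes the median cross one of polynomially many pairs of levels: it is at most
  \<open>a\<close> at time \<open>s\<close> and above \<open>b\<close> at time \<open>t\<close>. By counting, the independent variables
  \<open>D\<^sub>j = 1{B\<^sub>j(t) > b} - 1{B\<^sub>j(s) > a}\<close> then have a nonnegative sum, although each has mean of order \<open>-(b - a)\<close>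
  and is nonzero only with small probability, and a Chernoff bound applies. No conditioning on the median
  is needed. For \<open>n < q\<^sup>8\<close> the median moves by at most the largest single increment, which suffices.
  Dyadic chaining turns the estimates into a modulus of continuity that holds with high probability
  for all \<open>n\<close> at once, and paths with a common modulus form a compact set.
\<close>

section \<open>Counting characterisation of the median\<close>

text \<open>The exponents come from balancing powers of \<open>q\<close>. One step has standard
  deviation \<open>1 / q ^ 8\<close>, so for large \<open>n\<close> a variable \<open>D j\<close> is
  nonzero with probability \<open>V\<close> of order at most \<open>1 / q ^ 4\<close>, while the
  levels, in units of standard deviations, are \<open>1 / (q * sqrt n)\<close> apart, which is also
  the order of the mean. The exponent \<open>n * mean ^ 2 / V\<close> is then of order
  \<open>q ^ 2\<close>; a Hoeffding bound, blind to \<open>V\<close>, would yield only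
  \<open>1 / q ^ 2\<close>. For very small \<open>n\<close> the strip between the levels dominates
  \<open>V\<close> and the exponent degenerates to order \<open>sqrt n / q\<close>. The union bound
  over single increments has exponent \<open>2 * q ^ 14 / n\<close> instead, which is at least
  \<open>2 * q ^ 6\<close> as long as \<open>n < q ^ 8\<close>. Two further points shape the proof.
  The sample size is odd, so the median commutes with negation and every increment bound is proved
  one-sidedly. At time 0 there is no density, so the first dyadic step is treated apart.\<close>

lemma median_le_iff:
  "median (2 * k + 1) x \<le> a \<longleftrightarrow> card {j \<in> {1..2 * k + 1}. a < x j} \<le> k"
proof -
  define n where "n = 2 * k + 1"
  obtain \<tau> where s: "sorting_permutation n x \<tau>"
    using sorting_permutation_exists by blast
  have \<tau>: "\<tau> permutes {1..n}" using s by (simp add: sorting_permutation_def)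
  have m: "median n x = x (\<tau> (k + 1))"
    using median_eq[OF s] by (simp add: n_def)
  have card: "card (\<tau> ` S) = card S" for S
    using permutes_inj[OF \<tau>] by (intro card_image) (auto intro: inj_on_subset)
  have srt: "x (\<tau> i) \<le> x (\<tau> j)" if "1 \<le> i" "i \<le> j" "j \<le> n" for i j
    using s that by (simp add: sorting_permutation_def)
  show ?thesis
  proof (cases "median n x \<le> a")
    case True
    have "{j \<in> {1..n}. a < x j} \<subseteq> \<tau> ` {k+2..n}"
    proof
      fix j assume j: "j \<in> {j \<in> {1..n}. a < x j}"
      then obtain i where i: "i \<in> {1..n}" "j = \<tau> i"
        using permutes_image[OF \<tau>] by blast
      have "\<not> i \<le> k + 1"
        using srt[of i "k + 1"] i j True m by (auto simp: n_def)
      then show "j \<in> \<tau> ` {k+2..n}" using i by auto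
    qed
    then have "card {j \<in> {1..n}. a < x j} \<le> card (\<tau> ` {k+2..n})"
      by (intro card_mono) auto
    then have "card {j \<in> {1..n}. a < x j} \<le> k" using card[of "{k+2..n}"] by (simp add: n_def)
    then show ?thesis using True by (simp add: n_def)
  next
    case False
    have "\<tau> ` {k+1..n} \<subseteq> {j \<in> {1..n}. a < x j}"
    proof
      fix j assume "j \<in> \<tau> ` {k+1..n}"
      then obtain i where i: "i \<in> {k+1..n}" "j = \<tau> i" by blast
      have "j \<in> {1..n}" using permutes_in_image[OF \<tau>, of i] i by auto
      then show "j \<in> {j \<in> {1..n}. a < x j}"
        using srt[of "k + 1" i] i False m by auto
    qed
    then have "card (\<tau> ` {k+1..n}) \<le> card {j \<in> {1..n}. a < x j}"
      by (intro card_mono) auto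
    then have "k + 1 \<le> card {j \<in> {1..n}. a < x j}" using card[of "{k+1..n}"] by (simp add: n_def)
    then show ?thesis using False by (simp add: n_def)
  qed
qed

lemma le_median_iff:
  "a \<le> median (2 * k + 1) x \<longleftrightarrow> card {j \<in> {1..2 * k + 1}. x j < a} \<le> k"
proof -
  define n where "n = 2 * k + 1"
  obtain \<tau> where s: "sorting_permutation n x \<tau>"
    using sorting_permutation_exists by blast
  have \<tau>: "\<tau> permutes {1..n}" using s by (simp add: sorting_permutation_def)
  have m: "median n x = x (\<tau> (k + 1))"
    using median_eq[OF s] by (simp add: n_def)
  have card: "card (\<tau> ` S) = card S" for S
    using permutes_inj[OF \<tau>] by (intro card_image) (auto intro: inj_on_subset)
  have srt: "x (\<tau> i) \<le> x (\<tau> j)" if "1 \<le> i" "i \<le> j" "j \<le> n" for i j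
    using s that by (simp add: sorting_permutation_def)
  show ?thesis
  proof (cases "a \<le> median n x")
    case True
    have "{j \<in> {1..n}. x j < a} \<subseteq> \<tau> ` {1..k}"
    proof
      fix j assume j: "j \<in> {j \<in> {1..n}. x j < a}"
      then obtain i where i: "i \<in> {1..n}" "j = \<tau> i"
        using permutes_image[OF \<tau>] by blast
      have "\<not> k + 1 \<le> i"
        using srt[of "k + 1" i] i j True m by (auto simp: n_def)
      then show "j \<in> \<tau> ` {1..k}" using i by auto
    qed
    then have "card {j \<in> {1..n}. x j < a} \<le> card (\<tau> ` {1..k})"
      by (intro card_mono) auto
    then show ?thesis using True card[of "{1..k}"] by (simp add: n_def)
  next
    case False
    have "\<tau> ` {1..k+1} \<subseteq> {j \<in> {1..n}. x j < a}"
    proof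
      fix j assume "j \<in> \<tau> ` {1..k+1}"
      then obtain i where i: "i \<in> {1..k+1}" "j = \<tau> i" by blast
      have "j \<in> {1..n}" using permutes_in_image[OF \<tau>, of i] i by (auto simp: n_def)
      then show "j \<in> {j \<in> {1..n}. x j < a}"
        using srt[of i "k + 1"] i False m by (auto simp: n_def)
    qed
    then have "card (\<tau> ` {1..k+1}) \<le> card {j \<in> {1..n}. x j < a}"
      by (intro card_mono) auto
    then have "k + 1 \<le> card {j \<in> {1..n}. x j < a}" using card[of "{1..k+1}"] by simp
    then show ?thesis using False by (simp add: n_def)
  qed
qed

text \<open>The two counting criteria have the same threshold \<open>k\<close> because position
  \<open>k + 1\<close> is the exact middle of \<open>2 * k + 1\<close>; negation exchanges them.
  This symmetry later supplies all lower bounds.\<close>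

lemma median_uminus: "median (2 * k + 1) (\<lambda>j. - x j) = - median (2 * k + 1) x"
proof -
  have "median (2 * k + 1) (\<lambda>j. - x j) \<le> a \<longleftrightarrow> - median (2 * k + 1) x \<le> a" for a
    using median_le_iff[of k "\<lambda>j. - x j" a] le_median_iff[of "- a" k x]
    by (simp add: less_minus_iff minus_le_iff)
  then show ?thesis by (metis order_antisym order_refl)
qed

lemma borel_measurable_median [measurable]:
  assumes [measurable]: "\<And>j. j \<in> {1..2 * k + 1} \<Longrightarrow> f j \<in> borel_measurable M"
  shows "(\<lambda>\<omega>. median (2 * k + 1) (\<lambda>j. f j \<omega>)) \<in> borel_measurable M"
proof (rule borel_measurableI_le)
  fix a
  have "{\<omega> \<in> space M. median (2 * k + 1) (\<lambda>j. f j \<omega>) \<le> a} =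
    {\<omega> \<in> space M. (\<Sum>j\<in>{1..2 * k + 1}. if a < f j \<omega> then 1 else 0 :: nat) \<le> k}"
    by (simp only: median_le_iff sum.inter_filter[symmetric] finite_atLeastAtMost card_eq_sum)
  also have "\<dots> \<in> sets M" by measurable
  finally show "{\<omega> \<in> space M. median (2 * k + 1) (\<lambda>j. f j \<omega>) \<le> a} \<in> sets M" .
qed

lemma sum_indicator_greaterThan:
  assumes "finite A"
  shows "(\<Sum>j\<in>A. indicat_real {c<..} (w j)) = card {j \<in> A. c < w j}"
proof -
  have "(\<Sum>j\<in>A. indicat_real {c<..} (w j)) = (\<Sum>j\<in>A. if c < w j then 1 else 0)"
    by (intro sum.cong) (auto simp: indicator_def)
  then show ?thesis using assms by (simp add: sum.inter_filter[symmetric])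
qed

text \<open>At most \<open>k\<close> of the \<open>u j\<close> exceed \<open>a\<close> and at least
  \<open>k + 1\<close> of the \<open>v j\<close> exceed \<open>b\<close>, so the sum is even at
  least 1.\<close>

lemma sum_indicator_diff_nonneg:
  assumes "median (2 * k + 1) u \<le> a" "b < median (2 * k + 1) v"
  shows "0 \<le> (\<Sum>j\<in>{1..2 * k + 1}. indicat_real {b<..} (v j) - indicat_real {a<..} (u j))"
  using median_le_iff[of k u a] median_le_iff[of k v b] assms
  by (simp only: sum_subtractf sum_indicator_greaterThan finite_atLeastAtMost) simp

lemma sum_sign_nonneg:
  assumes "b < median (2 * k + 1) v"
  shows "0 \<le> (\<Sum>j\<in>{1..2 * k + 1}. 2 * indicat_real {b<..} (v j) - 1)"
  using median_le_iff[of k v b] assms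
  by (simp only: sum_subtractf sum_distrib_left[symmetric] sum_indicator_greaterThan
      finite_atLeastAtMost) simp

section \<open>Chernoff bound and Gaussian estimates\<close>

text \<open>For negative \<open>z = - w\<close> both sides are multiplied by
  \<open>1 + w + w\<^sup>2 / 2\<close>, a lower bound of \<open>exp w = 1 / exp z\<close>; the
  product on the right exceeds 1 by \<open>(w\<^sup>2 + w ^ 3 + w ^ 4) / 2\<close>.\<close>

lemma exp_le_quadratic:
  fixes z :: real
  assumes "\<bar>z\<bar> \<le> 1"
  shows "exp z \<le> 1 + z + z\<^sup>2"
proof (cases "z \<ge> 0")
  case True
  then show ?thesis using exp_bound[of z] assms by simp
next
  case False
  define w where "w = - z"
  have w: "w \<ge> 0" using False by (simp add: w_def)
  have "exp z * (1 + w + w\<^sup>2 / 2) \<le> exp z * exp w"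
    by (intro mult_left_mono exp_lower_Taylor_quadratic w) simp
  also have "\<dots> = 1" by (simp add: w_def exp_minus)
  also have "1 \<le> 1 + (w\<^sup>2 + w ^ 3 + w ^ 4) / 2" using w by simp
  also have "\<dots> = (1 + z + z\<^sup>2) * (1 + w + w\<^sup>2 / 2)"
    by (simp add: w_def power2_eq_square power3_eq_cube power4_eq_xxxx field_simps)
  finally show ?thesis
    using w by (simp add: mult_le_cancel_right add_pos_nonneg not_less)
qed

text \<open>A Bernstein-type bound: since the variables are at most 1 in absolute value, their
  squares are at most their absolute values, so the first absolute moment \<open>V\<close> takes the
  place of the variance.\<close>

lemma (in prob_space) prob_sum_nonneg_le:
  fixes D :: "'i \<Rightarrow> 'a \<Rightarrow> real"
  assumes I: "finite I" and indep: "indep_vars (\<lambda>_. borel) D I"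
    and bnd: "\<And>i \<omega>. i \<in> I \<Longrightarrow> \<omega> \<in> space M \<Longrightarrow> \<bar>D i \<omega>\<bar> \<le> 1"
    and mean: "\<And>i. i \<in> I \<Longrightarrow> expectation (D i) \<le> - \<mu>"
    and first: "\<And>i. i \<in> I \<Longrightarrow> expectation (\<lambda>\<omega>. \<bar>D i \<omega>\<bar>) \<le> V"
    and \<mu>: "\<mu> \<ge> 0" and V: "V > 0"
  shows "prob {\<omega> \<in> space M. 0 \<le> (\<Sum>i\<in>I. D i \<omega>)} \<le> exp (- (real (card I) * \<mu>\<^sup>2 / (4 * V)))"
proof (cases "I = {}")
  case True
  then show ?thesis by simp
next
  case False
  have D[measurable]: "D i \<in> borel_measurable M" if "i \<in> I" for i
    using indep that by (auto simp: indep_vars_def)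
  have int: "integrable M (D i)" if "i \<in> I" for i
    using that bnd[OF that] by (auto intro!: integrable_const_bound[where B = 1])
  \<comment> \<open>The minimiser of \<open>- \<theta> * \<mu> + \<theta>\<^sup>2 * V\<close>. The
    inequality \<open>\<mu> \<le> V\<close> shown next gives \<open>\<theta> \<le> 1\<close>, which
    keeps the exponents in the range of \<open>exp_le_quadratic\<close>.\<close>
  define \<theta> where "\<theta> = \<mu> / (2 * V)"
  obtain i where i: "i \<in> I" using False by blast
  have "\<mu> \<le> expectation (\<lambda>\<omega>. - D i \<omega>)" using mean[OF i] int[OF i] by simp
  also have "\<dots> \<le> expectation (\<lambda>\<omega>. \<bar>D i \<omega>\<bar>)"
    using int i by (intro integral_mono) auto
  also have "\<dots> \<le> V" using first i by blast
  finally have "\<mu> \<le> V" .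
  then have \<theta>: "0 \<le> \<theta>" "\<theta> \<le> 1" using \<mu> V by (auto simp: \<theta>_def field_simps)
  have intexp: "integrable M (\<lambda>\<omega>. exp (\<theta> * D i \<omega>))" if "i \<in> I" for i
    using that bnd[OF that] \<theta>
    by (intro integrable_const_bound[where B = "exp 1"] AE_I2)
      (auto simp: abs_le_iff intro: order_trans[OF mult_left_mono[of _ 1]])
  have mgf: "expectation (\<lambda>\<omega>. exp (\<theta> * D i \<omega>)) \<le> exp (- (\<mu>\<^sup>2 / (4 * V)))" if "i \<in> I" for i
  proof -
    have "expectation (\<lambda>\<omega>. exp (\<theta> * D i \<omega>)) \<le> expectation (\<lambda>\<omega>. 1 + \<theta> * D i \<omega> + \<theta>\<^sup>2 * \<bar>D i \<omega>\<bar>)"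
    proof (intro integral_mono intexp that)
      fix \<omega> assume "\<omega> \<in> space M"
      then have "\<bar>\<theta> * D i \<omega>\<bar> \<le> 1" using bnd[OF that] \<theta> by (simp add: abs_mult mult_le_one)
      then have "exp (\<theta> * D i \<omega>) \<le> 1 + \<theta> * D i \<omega> + \<theta>\<^sup>2 * \<bar>D i \<omega>\<bar>\<^sup>2"
        using exp_le_quadratic[of "\<theta> * D i \<omega>"] by (simp add: power_mult_distrib)
      also have "\<bar>D i \<omega>\<bar>\<^sup>2 \<le> \<bar>D i \<omega>\<bar>"
        using bnd[OF that \<open>\<omega> \<in> space M\<close>] by (simp add: power2_eq_square mult_left_le_one_le del: abs_mult_self)
      finally show "exp (\<theta> * D i \<omega>) \<le> 1 + \<theta> * D i \<omega> + \<theta>\<^sup>2 * \<bar>D i \<omega>\<bar>"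
        by (simp add: mult_left_mono)
    qed (use int that in auto)
    also have "\<dots> = 1 + \<theta> * expectation (D i) + \<theta>\<^sup>2 * expectation (\<lambda>\<omega>. \<bar>D i \<omega>\<bar>)"
      using int that by (simp add: prob_space)
    also have "\<dots> \<le> 1 + \<theta> * (- \<mu>) + \<theta>\<^sup>2 * V"
      using mean first that \<theta> by (intro add_mono mult_left_mono) auto
    also have "\<dots> = 1 + (- (\<mu>\<^sup>2 / (4 * V)))"
      using V by (simp add: \<theta>_def power2_eq_square field_simps)
    also have "\<dots> \<le> exp (- (\<mu>\<^sup>2 / (4 * V)))" by (rule exp_ge_add_one_self)
    finally show ?thesis .
  qed
  have indep': "indep_vars (\<lambda>_. borel) (\<lambda>i \<omega>. exp (\<theta> * D i \<omega>)) I"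
    by (rule indep_vars_compose2[OF indep]) simp
  have "prob {\<omega> \<in> space M. 0 \<le> (\<Sum>i\<in>I. D i \<omega>)} =
      expectation (indicator {\<omega> \<in> space M. 0 \<le> (\<Sum>i\<in>I. D i \<omega>)})"
    unfolding Bochner_Integration.integral_indicator by (auto intro!: arg_cong[where f = prob])
  also have "\<dots> \<le> expectation (\<lambda>\<omega>. \<Prod>i\<in>I. exp (\<theta> * D i \<omega>))"
  proof (intro integral_mono indep_vars_integrable I indep')
    fix \<omega>
    show "indicator {\<omega> \<in> space M. 0 \<le> (\<Sum>i\<in>I. D i \<omega>)} \<omega> \<le> (\<Prod>i\<in>I. exp (\<theta> * D i \<omega>))"
      using \<theta> I by (auto simp: indicator_def exp_sum[symmetric] sum_distrib_left[symmetric] intro: prod_nonneg)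
  qed (use intexp I in \<open>auto intro!: integrable_real_indicator simp: emeasure_eq_measure\<close>)
  also have "\<dots> = (\<Prod>i\<in>I. expectation (\<lambda>\<omega>. exp (\<theta> * D i \<omega>)))"
    by (intro indep_vars_lebesgue_integral I indep' intexp)
  also have "\<dots> \<le> (\<Prod>i\<in>I. exp (- (\<mu>\<^sup>2 / (4 * V))))"
    by (intro prod_mono conjI mgf integral_nonneg) auto
  also have "\<dots> = exp (- (real (card I) * \<mu>\<^sup>2 / (4 * V)))"
    by (simp add: exp_of_nat_mult[symmetric])
  finally show ?thesis .
qed

definition std_normal_tail :: "real \<Rightarrow> real" where
  "std_normal_tail u = measure (density lborel std_normal_density) {u<..}"

text \<open>An interval of length at most 1 to the right of \<open>u\<close> stays inside [-3, 3],
  where the density is at least its value at 3. Truncating the gap at 1 achieves this without any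
  upper bound on \<open>w\<close>.\<close>

lemma std_normal_tail_diff_ge:
  assumes "\<bar>u\<bar> \<le> 2" "u \<le> w"
  shows "std_normal_tail w + std_normal_density 3 * min (w - u) 1 \<le> std_normal_tail u"
proof -
  let ?N = "density lborel std_normal_density"
  interpret N: prob_space ?N by (rule prob_space_normal_density) simp
  define d where "d = min (w - u) 1"
  have d: "0 \<le> d" "d \<le> 1" "u + d \<le> w" using assms by (auto simp: d_def)
  have "ennreal (std_normal_density 3 * d) = (\<integral>\<^sup>+x. ennreal (std_normal_density 3) * indicator {u<..u+d} x \<partial>lborel)"
    using d by (simp add: nn_integral_cmult_indicator ennreal_mult)
  also have "\<dots> \<le> (\<integral>\<^sup>+x. ennreal (std_normal_density x) * indicator {u<..u+d} x \<partial>lborel)"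
  proof (intro nn_integral_mono)
    fix x
    show "ennreal (std_normal_density 3) * indicator {u<..u+d} x \<le> ennreal (std_normal_density x) * indicator {u<..u+d} x"
    proof (cases "x \<in> {u<..u+d}")
      case True
      then have "\<bar>x\<bar> \<le> \<bar>3\<bar>" using assms d by auto
      then have "x\<^sup>2 \<le> 3\<^sup>2" by (rule abs_le_square_iff[THEN iffD1])
      then show ?thesis
        using True by (auto simp: std_normal_density_def intro!: ennreal_leI divide_right_mono)
    qed simp
  qed
  also have "\<dots> = emeasure ?N {u<..u+d}"
    by (subst emeasure_density) auto
  finally have 1: "std_normal_density 3 * d \<le> measure ?N {u<..u+d}"
    by (simp add: N.emeasure_eq_measure)
  have "measure ?N {u<..u+d} + measure ?N {w<..} = measure ?N ({u<..u+d} \<union> {w<..})"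
    using d by (intro N.finite_measure_Union[symmetric]) auto
  also have "\<dots> \<le> measure ?N {u<..}"
    using d assms by (intro N.finite_measure_mono) auto
  finally show ?thesis using 1 by (simp add: std_normal_tail_def d_def)
qed

context prob_space
begin

lemma prob_normal_greater:
  assumes X: "distributed M lborel X (normal_density 0 \<sigma>)" and \<sigma>: "\<sigma> > 0"
  shows "prob {\<omega> \<in> space M. u < X \<omega>} = std_normal_tail (u / \<sigma>)"
proof -
  have X': "distributed M lborel (\<lambda>\<omega>. X \<omega> / \<sigma>) std_normal_density"
    using X normal_standard_normal_convert[OF \<sigma>, of X 0] by simp
  have [measurable]: "X \<in> borel_measurable M" using X by (simp add: distributed_def)
  have "std_normal_tail (u / \<sigma>) = measure (distr M lborel (\<lambda>\<omega>. X \<omega> / \<sigma>)) {u / \<sigma><..}"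
    using X' by (simp add: std_normal_tail_def distributed_distr_eq_density)
  also have "\<dots> = prob {\<omega> \<in> space M. u < X \<omega>}"
    using \<sigma> by (subst measure_distr) (auto intro!: arg_cong[where f = prob] simp: field_simps)
  finally show ?thesis by simp
qed

lemma prob_normal_uminus:
  assumes "distributed M lborel X (normal_density 0 \<sigma>)" "\<sigma> > 0"
  shows "distributed M lborel (\<lambda>\<omega>. - X \<omega>) (normal_density 0 \<sigma>)"
  using normal_density_affine[OF assms, of "-1" 0] by simp

lemma prob_normal_interval_le:
  assumes X: "distributed M lborel X (normal_density 0 \<sigma>)" and \<sigma>: "\<sigma> > 0" and "a \<le> b"
  shows "prob {\<omega> \<in> space M. a \<le> X \<omega> \<and> X \<omega> \<le> b} \<le> (b - a) / \<sigma>"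
proof -
  have "emeasure M {\<omega> \<in> space M. a \<le> X \<omega> \<and> X \<omega> \<le> b} =
      (\<integral>\<^sup>+x. ennreal (normal_density 0 \<sigma> x) * indicator {a..b} x \<partial>lborel)"
    by (subst distributed_emeasure[OF X, symmetric]) (auto intro!: arg_cong[where f = "emeasure M"])
  also have "\<dots> \<le> (\<integral>\<^sup>+x. ennreal (1 / \<sigma>) * indicator {a..b} x \<partial>lborel)"
  proof (intro nn_integral_mono mult_right_mono ennreal_leI)
    fix x
    have "\<sigma> = sqrt (\<sigma>\<^sup>2)" using \<sigma> by simp
    also have "\<dots> \<le> sqrt (2 * pi * \<sigma>\<^sup>2)" using pi_gt3 by (intro real_sqrt_le_mono) (simp add: mult_le_cancel_right1)
    finally have "1 / sqrt (2 * pi * \<sigma>\<^sup>2) \<le> 1 / \<sigma>" using \<sigma> by (intro divide_left_mono) auto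
    then have "1 / sqrt (2 * pi * \<sigma>\<^sup>2) * exp (- (x - 0)\<^sup>2 / (2 * \<sigma>\<^sup>2)) \<le> 1 / \<sigma> * 1"
      using \<sigma> by (intro mult_mono) auto
    then show "normal_density 0 \<sigma> x \<le> 1 / \<sigma>" unfolding normal_density_def by simp
  qed simp
  also have "\<dots> = ennreal ((b - a) / \<sigma>)"
    using \<sigma> assms(3) by (subst nn_integral_cmult_indicator) (auto simp: ennreal_mult[symmetric])
  finally show ?thesis using \<sigma> assms(3) by (simp add: emeasure_eq_measure)
qed

text \<open>For \<open>x > r \<ge> 0\<close> one has
  \<open>x\<^sup>2 \<ge> r\<^sup>2 + (x - r)\<^sup>2\<close>. So beyond \<open>r\<close> the density
  is at most the claimed factor times the normal density centred at \<open>r\<close>, whose integral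
  is 1.\<close>

lemma prob_normal_greater_le:
  assumes X: "distributed M lborel X (normal_density 0 \<sigma>)" and \<sigma>: "\<sigma> > 0" and r: "r \<ge> 0"
  shows "prob {\<omega> \<in> space M. r < X \<omega>} \<le> exp (- (r\<^sup>2 / (2 * \<sigma>\<^sup>2)))"
proof -
  have "emeasure M {\<omega> \<in> space M. r < X \<omega>} =
      (\<integral>\<^sup>+x. ennreal (normal_density 0 \<sigma> x) * indicator {r<..} x \<partial>lborel)"
    by (subst distributed_emeasure[OF X, symmetric]) (auto intro!: arg_cong[where f = "emeasure M"])
  also have "\<dots> \<le> (\<integral>\<^sup>+x. ennreal (exp (- (r\<^sup>2 / (2 * \<sigma>\<^sup>2)))) * normal_density r \<sigma> x \<partial>lborel)"
  proof (intro nn_integral_mono)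
    fix x
    have "normal_density 0 \<sigma> x \<le> exp (- (r\<^sup>2 / (2 * \<sigma>\<^sup>2))) * normal_density r \<sigma> x" if "r < x"
    proof -
      have "r * r \<le> r * x" using that r by (intro mult_left_mono) auto
      then have "r\<^sup>2 + (x - r)\<^sup>2 \<le> x\<^sup>2" by (simp add: power2_eq_square algebra_simps)
      then have "exp (- x\<^sup>2 / (2 * \<sigma>\<^sup>2)) \<le> exp (- (r\<^sup>2 + (x - r)\<^sup>2) / (2 * \<sigma>\<^sup>2))"
        using \<sigma> by (intro exp_le_cancel_iff[THEN iffD2] divide_right_mono) auto
      also have "\<dots> = exp (- (r\<^sup>2 / (2 * \<sigma>\<^sup>2))) * exp (- (x - r)\<^sup>2 / (2 * \<sigma>\<^sup>2))"
        by (simp add: exp_add[symmetric] add_divide_distrib diff_divide_distrib)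
      finally have "exp (- x\<^sup>2 / (2 * \<sigma>\<^sup>2)) \<le> exp (- (r\<^sup>2 / (2 * \<sigma>\<^sup>2))) * exp (- (x - r)\<^sup>2 / (2 * \<sigma>\<^sup>2))" .
      from mult_left_mono[OF this, of "1 / sqrt (2 * pi * \<sigma>\<^sup>2)"]
      show ?thesis by (simp add: normal_density_def mult_ac)
    qed
    then show "ennreal (normal_density 0 \<sigma> x) * indicator {r<..} x \<le>
        ennreal (exp (- (r\<^sup>2 / (2 * \<sigma>\<^sup>2)))) * ennreal (normal_density r \<sigma> x)"
      by (auto simp: indicator_def ennreal_mult[symmetric] intro!: ennreal_leI)
  qed
  also have "\<dots> = ennreal (exp (- (r\<^sup>2 / (2 * \<sigma>\<^sup>2))))"
    using \<sigma> by (simp add: nn_integral_cmult nn_integral_eq_integral)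
  finally show ?thesis by (simp add: emeasure_eq_measure)
qed

lemma prob_normal_abs_greater_le:
  assumes X: "distributed M lborel X (normal_density 0 \<sigma>)" and \<sigma>: "\<sigma> > 0" and r: "r \<ge> 0"
  shows "prob {\<omega> \<in> space M. r < \<bar>X \<omega>\<bar>} \<le> 2 * exp (- (r\<^sup>2 / (2 * \<sigma>\<^sup>2)))"
proof -
  have [measurable]: "X \<in> borel_measurable M" using X by (simp add: distributed_def)
  have "{\<omega> \<in> space M. r < \<bar>X \<omega>\<bar>} = {\<omega> \<in> space M. r < X \<omega>} \<union> {\<omega> \<in> space M. r < - X \<omega>}"
    by auto
  then have "prob {\<omega> \<in> space M. r < \<bar>X \<omega>\<bar>} \<le> prob {\<omega> \<in> space M. r < X \<omega>} + prob {\<omega> \<in> space M. r < - X \<omega>}"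
    by (simp only:) (intro measure_Un_le; measurable)
  then show ?thesis
    using prob_normal_greater_le[OF X \<sigma> r] prob_normal_greater_le[OF prob_normal_uminus[OF X \<sigma>] \<sigma> r]
    by linarith
qed

end

section \<open>Increments of the scaled median\<close>

lemma (in prob_space) std_normal_tail_0_le:
  assumes X: "distributed M lborel X (normal_density 0 \<sigma>)" and \<sigma>: "\<sigma> > 0"
  shows "std_normal_tail 0 \<le> 1 / 2"
proof -
  have [measurable]: "X \<in> borel_measurable M" using X by (simp add: distributed_def)
  have "2 * std_normal_tail 0 = prob {\<omega> \<in> space M. 0 < X \<omega>} + prob {\<omega> \<in> space M. 0 < - X \<omega>}"
    using prob_normal_greater[OF X \<sigma>, of 0] prob_normal_greater[OF prob_normal_uminus[OF X \<sigma>] \<sigma>, of 0]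
    by simp
  also have "\<dots> = prob ({\<omega> \<in> space M. 0 < X \<omega>} \<union> {\<omega> \<in> space M. 0 < - X \<omega>})"
    by (intro finite_measure_Union[symmetric]) auto
  also have "\<dots> \<le> 1" by simp
  finally show ?thesis by simp
qed

section \<open>The unscaled median at one and at two fixed times\<close>

abbreviation c\<^sub>0 :: real where "c\<^sub>0 \<equiv> std_normal_density 3"

text \<open>A crossing looks at each motion at two times, hence the independence over
  \<open>j\<close> of pairs of values. As a locale these properties can be reinterpreted for
  \<open>- W\<close>, which turns upper bounds into lower bounds.\<close>

locale brownian_family = prob_space M for M :: "'a measure" +
  fixes W :: "nat \<Rightarrow> real \<Rightarrow> 'a \<Rightarrow> real" and k :: nat
  assumes zero: "\<And>j. j \<in> {1..2 * k + 1} \<Longrightarrow> AE \<omega> in M. W j 0 \<omega> = 0"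
    and increment: "\<And>j s t. j \<in> {1..2 * k + 1} \<Longrightarrow> 0 \<le> s \<Longrightarrow> s < t \<Longrightarrow>
      distributed M lborel (\<lambda>\<omega>. W j t \<omega> - W j s \<omega>) (normal_density 0 (sqrt (t - s)))"
    and indep: "\<And>s t. 0 \<le> s \<Longrightarrow> 0 \<le> t \<Longrightarrow>
      indep_vars (\<lambda>_. borel \<Otimes>\<^sub>M borel) (\<lambda>j \<omega>. (W j s \<omega>, W j t \<omega>)) {1..2 * k + 1}"
begin

abbreviation "n \<equiv> 2 * k + 1"

definition med :: "real \<Rightarrow> 'a \<Rightarrow> real" where
  "med t \<omega> = median n (\<lambda>j. W j t \<omega>)"

lemma W_measurable [measurable]:
  assumes "j \<in> {1..n}" "t \<ge> 0"
  shows "W j t \<in> borel_measurable M"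
proof -
  have "(\<lambda>\<omega>. (W j t \<omega>, W j t \<omega>)) \<in> M \<rightarrow>\<^sub>M borel \<Otimes>\<^sub>M borel"
    using indep[OF assms(2,2)] assms(1) by (auto simp: indep_vars_def)
  from measurable_compose[OF this measurable_fst] show ?thesis by simp
qed

lemma med_measurable [measurable]: "t \<ge> 0 \<Longrightarrow> med t \<in> borel_measurable M"
  unfolding med_def by (intro borel_measurable_median W_measurable)

lemma marginal:
  assumes j: "j \<in> {1..n}" and t: "t > 0"
  shows "distributed M lborel (W j t) (normal_density 0 (sqrt t))"
proof -
  have "distr M lborel (\<lambda>\<omega>. W j t \<omega> - W j 0 \<omega>) = distr M lborel (W j t)"
    using zero[OF j] W_measurable[OF j] t by (intro distr_cong_AE) auto
  then show ?thesis
    using increment[OF j order_refl t] W_measurable[OF j] t by (simp add: distributed_def)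
qed

lemma med_0: "AE \<omega> in M. med 0 \<omega> = 0"
proof -
  have "AE \<omega> in M. \<forall>j\<in>{1..n}. W j 0 \<omega> = 0"
    using zero by (intro AE_finite_allI) auto
  then show ?thesis
  proof eventually_elim
    case (elim \<omega>)
    have "{j \<in> {1..n}. 0 < W j 0 \<omega>} = {}" "{j \<in> {1..n}. W j 0 \<omega> < 0} = {}"
      using elim by auto
    then have "median n (\<lambda>j. W j 0 \<omega>) \<le> 0" "0 \<le> median n (\<lambda>j. W j 0 \<omega>)"
      unfolding median_le_iff le_median_iff by (simp_all only: card.empty le0)
    then show ?case by (simp add: med_def)
  qed
qed

lemma indep_image:
  assumes "0 \<le> s" "0 \<le> t" and [measurable]: "case_prod g \<in> borel_measurable (borel \<Otimes>\<^sub>M borel)"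
  shows "indep_vars (\<lambda>_. borel) (\<lambda>j \<omega>. g (W j s \<omega>) (W j t \<omega>) :: real) {1..n}"
  using indep_vars_compose2[OF indep[OF assms(1,2)], where Y = "\<lambda>_. case_prod g" and N = "\<lambda>_. borel"]
  by simp

text \<open>A median above the level needs a majority above it, while each motion is there with
  probability at most \<open>1 / 2 - c\<^sub>0 * min u 1\<close>. The signs \<open>D j\<close> have
  absolute value 1, so the Chernoff bound is applied with \<open>V = 1\<close>.\<close>

lemma prob_med_greater_le:
  assumes s: "s > 0" and u: "u \<ge> 0"
  shows "prob {\<omega> \<in> space M. u * sqrt s < med s \<omega>} \<le> exp (- (real n * (c\<^sub>0 * min u 1)\<^sup>2))"
proof -
  define D where "D j \<omega> = 2 * indicat_real {u * sqrt s<..} (W j s \<omega>) - 1" for j \<omega>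
  have mean: "expectation (D j) \<le> - (2 * (c\<^sub>0 * min u 1))" if j: "j \<in> {1..n}" for j
  proof -
    have [measurable]: "W j s \<in> borel_measurable M" using W_measurable[OF j] s by simp
    have "expectation (D j) = 2 * expectation (\<lambda>\<omega>. indicat_real {u * sqrt s<..} (W j s \<omega>)) - 1"
      unfolding D_def by (subst Bochner_Integration.integral_diff)
        (auto simp: prob_space intro!: integrable_const_bound[where B = 1])
    also have "expectation (\<lambda>\<omega>. indicat_real {u * sqrt s<..} (W j s \<omega>)) =
        expectation (indicat_real {\<omega> \<in> space M. u * sqrt s < W j s \<omega>})"
      by (intro Bochner_Integration.integral_cong) (auto simp: indicator_def)
    also have "\<dots> = prob {\<omega> \<in> space M. u * sqrt s < W j s \<omega>}"
      unfolding Bochner_Integration.integral_indicator by (auto intro!: arg_cong[where f = prob])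
    also have "\<dots> = std_normal_tail u"
      using prob_normal_greater[OF marginal[OF j s], of "u * sqrt s"] s by simp
    finally show ?thesis
      using std_normal_tail_diff_ge[of 0 u] u std_normal_tail_0_le[OF marginal[OF j s]] s by simp
  qed
  have "prob {\<omega> \<in> space M. u * sqrt s < med s \<omega>} \<le> prob {\<omega> \<in> space M. 0 \<le> (\<Sum>j\<in>{1..n}. D j \<omega>)}"
  proof (intro finite_measure_mono subsetI)
    fix \<omega> assume "\<omega> \<in> {\<omega> \<in> space M. u * sqrt s < med s \<omega>}"
    then show "\<omega> \<in> {\<omega> \<in> space M. 0 \<le> (\<Sum>j\<in>{1..n}. D j \<omega>)}"
      using sum_sign_nonneg[of "u * sqrt s" k "\<lambda>j. W j s \<omega>"] by (simp add: med_def D_def)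
  next
    have [measurable]: "D j \<in> borel_measurable M" if "j \<in> {1..n}" for j
      using W_measurable[OF that, of s] s unfolding D_def by simp
    show "{\<omega> \<in> space M. 0 \<le> (\<Sum>j\<in>{1..n}. D j \<omega>)} \<in> events" by measurable
  qed
  also have "\<dots> \<le> exp (- (real (card {1..n}) * (2 * (c\<^sub>0 * min u 1))\<^sup>2 / (4 * 1)))"
  proof (rule prob_sum_nonneg_le)
    show "indep_vars (\<lambda>_. borel) D {1..n}"
      unfolding D_def
      by (rule indep_image[of s s "\<lambda>x _. 2 * indicat_real {u * sqrt s<..} x - 1"]) (use s in auto)
    have "\<bar>D j \<omega>\<bar> = 1" for j \<omega> by (simp add: D_def indicator_def)
    then show "expectation (\<lambda>\<omega>. \<bar>D j \<omega>\<bar>) \<le> 1" "\<bar>D j \<omega>\<bar> \<le> 1" for j \<omega> by (simp_all add: prob_space)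
  qed (use mean u in auto)
  also have "\<dots> = exp (- (real n * (c\<^sub>0 * min u 1)\<^sup>2))"
    by (simp add: power_mult_distrib)
  finally show ?thesis .
qed

text \<open>With levels in units of standard deviations, both one-time probabilities are values of
  the same tail function, so the mean of \<open>D j\<close> is a tail difference. The joint law at
  the two times enters only through \<open>V\<close>.\<close>

lemma prob_med_crossing_le:
  assumes s: "0 < s" "s < t" and uw: "\<bar>u\<bar> \<le> 2" "u \<le> w" and V: "V > 0"
    and first: "\<And>j. j \<in> {1..n} \<Longrightarrow>
      prob {\<omega> \<in> space M. (u * sqrt s < W j s \<omega>) \<noteq> (w * sqrt t < W j t \<omega>)} \<le> V"
  shows "prob {\<omega> \<in> space M. med s \<omega> \<le> u * sqrt s \<and> w * sqrt t < med t \<omega>} \<le>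
    exp (- (real n * (c\<^sub>0 * min (w - u) 1)\<^sup>2 / (4 * V)))"
proof -
  define D where "D j \<omega> = indicat_real {w * sqrt t<..} (W j t \<omega>) - indicat_real {u * sqrt s<..} (W j s \<omega>)" for j \<omega>
  have t: "t > 0" using s by simp
  have D[measurable]: "D j \<in> borel_measurable M" if "j \<in> {1..n}" for j
    using W_measurable[OF that, of s] W_measurable[OF that, of t] s t unfolding D_def by simp
  have tail: "expectation (\<lambda>\<omega>. indicat_real {v * sqrt r<..} (W j r \<omega>)) = std_normal_tail v"
    if j: "j \<in> {1..n}" and r: "r > 0" for v r j
  proof -
    have "expectation (\<lambda>\<omega>. indicat_real {v * sqrt r<..} (W j r \<omega>)) =
        expectation (indicat_real {\<omega> \<in> space M. v * sqrt r < W j r \<omega>})"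
      by (intro Bochner_Integration.integral_cong) (auto simp: indicator_def)
    also have "\<dots> = prob {\<omega> \<in> space M. v * sqrt r < W j r \<omega>}"
      unfolding Bochner_Integration.integral_indicator by (auto intro!: arg_cong[where f = prob])
    also have "\<dots> = std_normal_tail v"
      using prob_normal_greater[OF marginal[OF j r], of "v * sqrt r"] r by simp
    finally show ?thesis .
  qed
  have mean: "expectation (D j) \<le> - (c\<^sub>0 * min (w - u) 1)" if j: "j \<in> {1..n}" for j
  proof -
    note [measurable] = W_measurable[OF j]
    have "expectation (D j) = std_normal_tail w - std_normal_tail u"
      unfolding D_def using s t
      by (subst Bochner_Integration.integral_diff)
        (auto simp: tail[OF j] intro!: integrable_const_bound[where B = 1])
    then show ?thesis using std_normal_tail_diff_ge[OF uw] by simp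
  qed
  have first': "expectation (\<lambda>\<omega>. \<bar>D j \<omega>\<bar>) \<le> V" if j: "j \<in> {1..n}" for j
  proof -
    have "expectation (\<lambda>\<omega>. \<bar>D j \<omega>\<bar>) =
        expectation (indicat_real {\<omega> \<in> space M. (u * sqrt s < W j s \<omega>) \<noteq> (w * sqrt t < W j t \<omega>)})"
      by (intro Bochner_Integration.integral_cong) (auto simp: indicator_def D_def)
    also have "\<dots> = prob {\<omega> \<in> space M. (u * sqrt s < W j s \<omega>) \<noteq> (w * sqrt t < W j t \<omega>)}"
      unfolding Bochner_Integration.integral_indicator by (auto intro!: arg_cong[where f = prob])
    finally show ?thesis using first[OF j] by simp
  qed
  have "prob {\<omega> \<in> space M. med s \<omega> \<le> u * sqrt s \<and> w * sqrt t < med t \<omega>} \<le>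
      prob {\<omega> \<in> space M. 0 \<le> (\<Sum>j\<in>{1..n}. D j \<omega>)}"
  proof (intro finite_measure_mono subsetI)
    fix \<omega> assume "\<omega> \<in> {\<omega> \<in> space M. med s \<omega> \<le> u * sqrt s \<and> w * sqrt t < med t \<omega>}"
    then show "\<omega> \<in> {\<omega> \<in> space M. 0 \<le> (\<Sum>j\<in>{1..n}. D j \<omega>)}"
      using sum_indicator_diff_nonneg[of k "\<lambda>j. W j s \<omega>" "u * sqrt s" "w * sqrt t" "\<lambda>j. W j t \<omega>"]
      by (simp add: med_def D_def)
  qed measurable
  also have "\<dots> \<le> exp (- (real (card {1..n}) * (c\<^sub>0 * min (w - u) 1)\<^sup>2 / (4 * V)))"
  proof (rule prob_sum_nonneg_le)
    show "indep_vars (\<lambda>_. borel) D {1..n}"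
      unfolding D_def
      by (rule indep_image[of s t "\<lambda>x y. indicat_real {w * sqrt t<..} y - indicat_real {u * sqrt s<..} x"])
        (use s t in auto)
    show "\<bar>D j \<omega>\<bar> \<le> 1" for j \<omega> by (simp add: D_def indicator_def)
  qed (use mean first' V uw in auto)
  finally show ?thesis by simp
qed

text \<open>If the increment is at most \<open>r\<close>, a change of side forces the value at time
  \<open>s\<close> into the strip from \<open>a - r\<close> to \<open>b + r\<close>, and the density
  at time \<open>s\<close> is at most \<open>1 / sqrt s\<close>.\<close>

lemma prob_sign_change_le:
  assumes j: "j \<in> {1..n}" and s: "0 < s" "s < t" and ab: "a \<le> b" and r: "r \<ge> 0"
  shows "prob {\<omega> \<in> space M. (a < W j s \<omega>) \<noteq> (b < W j t \<omega>)} \<le>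
    2 * exp (- (r\<^sup>2 / (2 * (t - s)))) + (b - a + 2 * r) / sqrt s"
proof -
  have [measurable]: "W j s \<in> borel_measurable M" "W j t \<in> borel_measurable M"
    using W_measurable[OF j] s by auto
  have "prob {\<omega> \<in> space M. (a < W j s \<omega>) \<noteq> (b < W j t \<omega>)} \<le>
      prob ({\<omega> \<in> space M. r < \<bar>W j t \<omega> - W j s \<omega>\<bar>} \<union> {\<omega> \<in> space M. a - r \<le> W j s \<omega> \<and> W j s \<omega> \<le> b + r})"
    using ab r by (intro finite_measure_mono) (auto simp: abs_le_iff not_less)
  also have "\<dots> \<le> prob {\<omega> \<in> space M. r < \<bar>W j t \<omega> - W j s \<omega>\<bar>} +
      prob {\<omega> \<in> space M. a - r \<le> W j s \<omega> \<and> W j s \<omega> \<le> b + r}"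
    by (intro measure_Un_le) measurable
  also have "\<dots> \<le> 2 * exp (- (r\<^sup>2 / (2 * (sqrt (t - s))\<^sup>2))) + (b + r - (a - r)) / sqrt s"
    using s ab r
    by (intro add_mono prob_normal_abs_greater_le prob_normal_interval_le increment marginal j) auto
  also have "\<dots> = 2 * exp (- (r\<^sup>2 / (2 * (t - s)))) + (b - a + 2 * r) / sqrt s"
    using s by (simp add: algebra_simps)
  finally show ?thesis .
qed

lemma prob_med_diff_greater_le:
  assumes s: "0 \<le> s" "s < t" and e: "e \<ge> 0"
  shows "prob {\<omega> \<in> space M. e < \<bar>med t \<omega> - med s \<omega>\<bar>} \<le> 2 * real n * exp (- (e\<^sup>2 / (2 * (t - s))))"
proof -
  have [measurable]: "W j s \<in> borel_measurable M" "W j t \<in> borel_measurable M" if "j \<in> {1..n}" for j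
    using W_measurable[OF that] s by auto
  have "prob {\<omega> \<in> space M. e < \<bar>med t \<omega> - med s \<omega>\<bar>} \<le>
      prob (\<Union>j\<in>{1..n}. {\<omega> \<in> space M. e < \<bar>W j t \<omega> - W j s \<omega>\<bar>})"
  proof (intro finite_measure_mono subsetI)
    fix \<omega> assume \<omega>: "\<omega> \<in> {\<omega> \<in> space M. e < \<bar>med t \<omega> - med s \<omega>\<bar>}"
    show "\<omega> \<in> (\<Union>j\<in>{1..n}. {\<omega> \<in> space M. e < \<bar>W j t \<omega> - W j s \<omega>\<bar>})"
    proof (rule ccontr)
      assume "\<not> ?thesis"
      then have "\<bar>W j t \<omega> - W j s \<omega>\<bar> \<le> e" if "j \<in> {1..n}" for j using that \<omega> by force
      then have "\<bar>med t \<omega> - med s \<omega>\<bar> \<le> e" unfolding med_def by (intro median_diff_le) auto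
      then show False using \<omega> by simp
    qed
  qed (intro sets.finite_UN; measurable)
  also have "\<dots> \<le> (\<Sum>j\<in>{1..n}. prob {\<omega> \<in> space M. e < \<bar>W j t \<omega> - W j s \<omega>\<bar>})"
    by (intro measure_UNION_le) (auto intro!: measurable)
  also have "\<dots> \<le> (\<Sum>j\<in>{1..n}. 2 * exp (- (e\<^sup>2 / (2 * (sqrt (t - s))\<^sup>2))))"
    using s e by (intro sum_mono prob_normal_abs_greater_le increment) auto
  also have "\<dots> = 2 * real n * exp (- (e\<^sup>2 / (2 * (t - s))))"
    using s by simp
  finally show ?thesis .
qed

end

section \<open>One level crossed by the scaled median during one step\<close>

lemma std_normal_density_le_1: "std_normal_density x \<le> 1"
proof -
  have "1 \<le> sqrt (2 * pi)" using pi_gt3 by (simp add: real_le_rsqrt)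
  moreover have "exp (- x\<^sup>2 / 2) \<le> 1" by simp
  ultimately have "exp (- x\<^sup>2 / 2) \<le> sqrt (2 * pi)" by (rule order_trans[rotated])
  then show ?thesis by (simp add: std_normal_density_def)
qed

text \<open>
  The factor 224 collects the losses in \<open>crossing_exponent\<close>: 4 from the Chernoff bound, 4 from halving the
  gap between the levels, 7 from the probability of a sign change, 2 from \<open>t \<le> 2 * T * sqrt s\<close>.
\<close>

definition rate :: "real \<Rightarrow> real" where
  "rate T = c\<^sub>0\<^sup>2 / (224 * T\<^sup>2)"

lemma rate_pos: "T \<ge> 1 \<Longrightarrow> rate T > 0"
  using normal_density_pos[of 1 0 3] by (auto simp: rate_def intro!: divide_pos_pos)

lemma rate_le: "T \<ge> 1 \<Longrightarrow> rate T \<le> c\<^sub>0\<^sup>2 / 4"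
proof -
  assume "T \<ge> 1"
  then have "4 \<le> 224 * T\<^sup>2" using one_le_power[of T 2] by linarith
  then show ?thesis unfolding rate_def by (intro divide_left_mono) auto
qed

lemma rate_le_c\<^sub>0: "T \<ge> 1 \<Longrightarrow> rate T \<le> c\<^sub>0\<^sup>2"
  using rate_le[of T] zero_le_power2[of "c\<^sub>0"] by linarith

lemma rate_le_1: "T \<ge> 1 \<Longrightarrow> rate T \<le> 1"
  using rate_le[of T] power_mono[OF std_normal_density_le_1[of 3], of 2] by simp

context brownian_family
begin

definition X :: "real \<Rightarrow> 'a \<Rightarrow> real" where
  "X t \<omega> = sqrt (real n) * med t \<omega>"

lemma X_measurable [measurable]: "t \<ge> 0 \<Longrightarrow> X t \<in> borel_measurable M"
  unfolding X_def by measurable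

text \<open>
  In units of standard deviations the level \<open>A\<close> shrinks between the two times, and the gap \<open>1 / q\<close> must
  outweigh this drift; that is why \<open>A\<close> is bounded in terms of \<open>sqrt s\<close>.
\<close>

lemma crossing_exponent:
  assumes q: "q \<ge> 2" and T: "T \<ge> 1" "s + 1 / q ^ 16 \<le> T" and s: "1 / q ^ 16 \<le> s"
    and n: "q ^ 8 \<le> real n"
    and A: "\<bar>A\<bar> \<le> q ^ 4 * sqrt s + 1 / q ^ 8"
  shows "prob {\<omega> \<in> space M. X s \<omega> \<le> A \<and> A + 1 / q < X (s + 1 / q ^ 16) \<omega>} \<le> exp (- (rate T * q\<^sup>2))"
proof -
  define N where "N = sqrt (real n)"
  define \<delta> where "\<delta> = 1 / q ^ 16"
  define t where "t = s + \<delta>"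
  have q0: "q > 0" using q by simp
  have \<delta>: "\<delta> > 0" "sqrt \<delta> = 1 / q ^ 8" "\<delta> \<le> s" "t \<le> T"
  proof -
    show "\<delta> > 0" "\<delta> \<le> s" "t \<le> T" using q0 s T by (auto simp: \<delta>_def t_def)
    have "\<delta> = (1 / q ^ 8)\<^sup>2" by (simp add: \<delta>_def power_divide flip: power_mult)
    then show "sqrt \<delta> = 1 / q ^ 8" using q0 by simp
  qed
  have st: "0 < s" "s < t" "0 < t" "t \<le> 2 * s" "s \<le> T" using \<delta> by (auto simp: t_def)
  have sqs: "1 / q ^ 8 \<le> sqrt s" using \<delta> real_sqrt_le_mono[of \<delta> s] by simp
  have sqt: "sqrt t \<le> sqrt s + 1 / q ^ 8"
    using sqrt_add_le_add_sqrt[of s \<delta>] \<delta> st by (simp add: t_def)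
  have sqT: "sqrt x \<le> T" if "0 \<le> x" "x \<le> T" for x
    using that T by (intro real_le_lsqrt) (auto simp: power2_eq_square intro: order_trans[OF _ mult_mono[of 1 T T T]])
  have q4: "q ^ 4 \<ge> 16" using power_mono[of 2 q 4] q by simp
  have Nq: "N \<ge> q ^ 4"
  proof -
    have "(q ^ 4)\<^sup>2 \<le> real n" using n by (simp flip: power_mult)
    then show ?thesis unfolding N_def by (rule real_le_rsqrt)
  qed
  then have N0: "N > 0" using q4 by simp
  have N2: "N\<^sup>2 = real n" by (simp add: N_def)
  define u where "u = A / (N * sqrt s)"
  define w where "w = (A + 1 / q) / (N * sqrt t)"
  \<comment> \<open>Half of the gap \<open>1 / (q * N * sqrt t)\<close> that would remain if the
    level did not drift; the other half is reserved for the drift.\<close>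
  define d where "d = 1 / (2 * q * N * sqrt t)"
  have us: "u * sqrt s = A / N" and wt: "w * sqrt t = (A + 1 / q) / N"
    using st N0 by (simp_all add: u_def w_def)
  have As: "\<bar>A\<bar> \<le> (q ^ 4 + 1) * sqrt s" using A sqs by (simp add: algebra_simps)
  \<comment> \<open>The assumption \<open>q ^ 8 \<le> n\<close> acts here: after division by
    \<open>N\<close>, levels up to \<open>(q ^ 4 + 1) * sqrt s\<close> lie within two standard
    deviations, where \<open>std_normal_tail_diff_ge\<close> applies.\<close>
  have "\<bar>u\<bar> \<le> 2"
  proof -
    have "\<bar>A\<bar> \<le> 2 * N * sqrt s"
      by (rule order_trans[OF As]) (use Nq q4 st in \<open>intro mult_right_mono; simp\<close>)
    then show ?thesis using N0 st by (simp add: u_def abs_mult field_simps)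
  qed
  have dw: "d \<le> w - u"
  proof -
    \<comment> \<open>The drift cleared of denominators. It helps when \<open>A\<close> is
      nonpositive; otherwise it is controlled by \<open>sqrt t - sqrt s \<le> 1 / q ^ 8\<close>, the
      root of the step length.\<close>
    have "A * (sqrt t - sqrt s) \<le> sqrt s / (2 * q)"
    proof (cases "A \<le> 0")
      case True
      then have "A * (sqrt t - sqrt s) \<le> 0" using st by (intro mult_nonpos_nonneg) auto
      also have "0 \<le> sqrt s / (2 * q)" using st q0 by simp
      finally show ?thesis .
    next
      case False
      have "A * (sqrt t - sqrt s) \<le> (q ^ 4 + 1) * sqrt s * (1 / q ^ 8)"
        using As sqt False st q0 by (intro mult_mono) auto
      also have "\<dots> = sqrt s * ((q ^ 4 + 1) / q ^ 8)" by simp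
      also have "(q ^ 4 + 1) / q ^ 8 \<le> 1 / (2 * q)"
      proof -
        have "(q ^ 4 + 1) * (2 * q) \<le> (2 * q ^ 4) * (2 * q)" using q4 q0 by (intro mult_right_mono) auto
        also have "\<dots> = q ^ 5 * 4" by (simp add: eval_nat_numeral)
        also have "\<dots> \<le> q ^ 5 * q ^ 3"
          using power_mono[of 2 q 3] q q0 by (intro mult_left_mono) auto
        also have "\<dots> = q ^ 8" by (simp flip: power_add)
        finally show ?thesis using q0 by (simp add: field_simps)
      qed
      then have "sqrt s * ((q ^ 4 + 1) / q ^ 8) \<le> sqrt s * (1 / (2 * q))"
        using st by (intro mult_left_mono) auto
      finally show ?thesis by simp
    qed
    then have "A * sqrt t + sqrt s / (2 * q) \<le> (A + 1 / q) * sqrt s"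
      by (simp add: algebra_simps add_divide_distrib[symmetric])
    then have "(A * sqrt t + sqrt s / (2 * q)) / (N * sqrt s * sqrt t) \<le> (A + 1 / q) * sqrt s / (N * sqrt s * sqrt t)"
      using N0 st by (intro divide_right_mono) auto
    also have "(A + 1 / q) * sqrt s / (N * sqrt s * sqrt t) = w"
      using st by (simp add: w_def)
    also have "(A * sqrt t + sqrt s / (2 * q)) / (N * sqrt s * sqrt t) = u + d"
      using st N0 q0 by (simp add: u_def d_def add_divide_distrib)
    finally show ?thesis by simp
  qed
  have d0: "d > 0" using q0 N0 st by (simp add: d_def)
  have c0: "c\<^sub>0 > 0" by (simp add: normal_density_pos)
  have eq: "{\<omega> \<in> space M. X s \<omega> \<le> A \<and> A + 1 / q < X t \<omega>} =
      {\<omega> \<in> space M. med s \<omega> \<le> u * sqrt s \<and> w * sqrt t < med t \<omega>}"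
  proof -
    have "X r \<omega> = N * med r \<omega>" for r \<omega> by (simp add: X_def N_def)
    then show ?thesis using N0 by (auto simp: us wt field_simps)
  qed
  have main: "prob {\<omega> \<in> space M. X s \<omega> \<le> A \<and> A + 1 / q < X t \<omega>} \<le> exp (- (rate T * q\<^sup>2))"
    if V: "V > 0" and "rate T * q\<^sup>2 \<le> real n * (c\<^sub>0 * min d 1)\<^sup>2 / (4 * V)"
      and first: "\<And>j. j \<in> {1..n} \<Longrightarrow> prob {\<omega> \<in> space M. (A / N < W j s \<omega>) \<noteq> ((A + 1 / q) / N < W j t \<omega>)} \<le> V"
    for V
  proof -
    have "prob {\<omega> \<in> space M. X s \<omega> \<le> A \<and> A + 1 / q < X t \<omega>} \<le>
        exp (- (real n * (c\<^sub>0 * min (w - u) 1)\<^sup>2 / (4 * V)))"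
      unfolding eq using \<open>\<bar>u\<bar> \<le> 2\<close> dw d0 V first
      by (intro prob_med_crossing_le st) (auto simp: us wt)
    also have "\<dots> \<le> exp (- (real n * (c\<^sub>0 * min d 1)\<^sup>2 / (4 * V)))"
    proof -
      have "(c\<^sub>0 * min d 1)\<^sup>2 \<le> (c\<^sub>0 * min (w - u) 1)\<^sup>2"
        using dw d0 c0 by (intro power_mono mult_left_mono) auto
      then show ?thesis using V by (simp add: divide_right_mono mult_left_mono)
    qed
    also have "\<dots> \<le> exp (- (rate T * q\<^sup>2))" using that(2) by simp
    finally show ?thesis .
  qed
  show ?thesis
    unfolding \<delta>_def[symmetric] t_def[symmetric]
  proof (cases "d \<ge> 1")
    case True
    \<comment> \<open>With a gap of a full standard deviation the trivial \<open>V = 1\<close>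
      already gives the exponent \<open>n * c\<^sub>0\<^sup>2 / 4\<close>.\<close>
    show "prob {\<omega> \<in> space M. X s \<omega> \<le> A \<and> A + 1 / q < X t \<omega>} \<le> exp (- (rate T * q\<^sup>2))"
    proof (rule main[of 1])
      have "q\<^sup>2 \<le> real n" using n power_increasing[of 2 8 q] q by linarith
      then have "rate T * q\<^sup>2 \<le> c\<^sub>0\<^sup>2 / 4 * real n"
        using rate_le[OF T(1)] by (intro mult_mono) auto
      then show "rate T * q\<^sup>2 \<le> real n * (c\<^sub>0 * min d 1)\<^sup>2 / (4 * 1)"
        using True by (simp add: mult.commute)
    qed auto
  next
    case False
    \<comment> \<open>The 7 is 4 + 3: the Gaussian tail of the increment beyond
      \<open>r = 1 / q ^ 4\<close> contributes 4, and the strip, of width at most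
      \<open>3 / q ^ 4\<close>, contributes 3.\<close>
    define V where "V = 7 * T / (q ^ 4 * sqrt s)"
    show "prob {\<omega> \<in> space M. X s \<omega> \<le> A \<and> A + 1 / q < X t \<omega>} \<le> exp (- (rate T * q\<^sup>2))"
    proof (rule main[of V])
      show "V > 0" using T st q0 by (simp add: V_def)
      \<comment> \<open>The exponent carries the factor \<open>sqrt s / t\<close>, with
        \<open>sqrt s\<close> from \<open>1 / V\<close> and \<open>1 / t\<close> from
        \<open>d\<^sup>2\<close>. The estimate bounds it below uniformly down to
        \<open>s = \<delta>\<close>, using \<open>t \<le> 2 * s\<close>.\<close>
      have "sqrt t * sqrt t \<le> (2 * sqrt s) * T"
      proof (intro mult_mono)
        show "sqrt t \<le> 2 * sqrt s" using st by (intro real_le_lsqrt) (auto simp: power_mult_distrib)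
        show "sqrt t \<le> T" using sqT st \<delta> by simp
      qed (use st in auto)
      then have "t \<le> 2 * T * sqrt s" using st by (simp add: mult_ac)
      then have *: "112 * T * t \<le> 224 * T\<^sup>2 * sqrt s"
        using mult_left_mono[of t "2 * T * sqrt s" "112 * T"] T by (simp add: power2_eq_square mult_ac)
      have "min d 1 = d" using False by simp
      then have "real n * (c\<^sub>0 * min d 1)\<^sup>2 / (4 * V) = N\<^sup>2 * c\<^sub>0\<^sup>2 * d\<^sup>2 * (q ^ 4 * sqrt s) / (28 * T)"
        unfolding N2 V_def power_mult_distrib by simp
      also have "\<dots> = N\<^sup>2 * c\<^sub>0\<^sup>2 * (1 / (2 * q * N * sqrt t))\<^sup>2 * (q ^ 4 * sqrt s) / (28 * T)"
        by (simp add: d_def)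
      also have "\<dots> = c\<^sub>0\<^sup>2 * q\<^sup>2 * (sqrt s / (112 * T * t))"
        using N0 q0 st T by (simp add: power_divide power_mult_distrib field_simps eval_nat_numeral)
      also have "\<dots> \<ge> c\<^sub>0\<^sup>2 * q\<^sup>2 * (1 / (224 * T\<^sup>2))"
        using * st T by (intro mult_left_mono) (auto simp: field_simps)
      finally show "rate T * q\<^sup>2 \<le> real n * (c\<^sub>0 * min d 1)\<^sup>2 / (4 * V)"
        by (simp add: rate_def mult_ac)
    next
      fix j assume j: "j \<in> {1..n}"
      \<comment> \<open>The radius \<open>1 / q ^ 4\<close> is \<open>q ^ 4\<close> standard
        deviations of the step, so even the crude \<open>exp (- y) \<le> 1 / y\<close> brings the
        tail below the order of \<open>V\<close>.\<close>
      have ex: "exp (- ((1 / q ^ 4)\<^sup>2 / (2 * (t - s)))) \<le> 2 / q ^ 8"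
      proof -
        have eq: "(1 / q ^ 4)\<^sup>2 / (2 * (t - s)) = q ^ 8 / 2"
          using q0 by (simp add: t_def \<delta>_def power_divide field_simps flip: power_mult power_add)
        have "exp (- (q ^ 8 / 2)) \<le> 1 / (q ^ 8 / 2)"
        proof -
          have "q ^ 8 / 2 \<le> exp (q ^ 8 / 2)" using exp_ge_add_one_self[of "q ^ 8 / 2"] by linarith
          then show ?thesis using q0 by (simp add: exp_minus field_simps)
        qed
        then show ?thesis unfolding eq by simp
      qed
      have "prob {\<omega> \<in> space M. (A / N < W j s \<omega>) \<noteq> ((A + 1 / q) / N < W j t \<omega>)} \<le>
        2 * exp (- ((1 / q ^ 4)\<^sup>2 / (2 * (t - s)))) + ((A + 1 / q) / N - A / N + 2 * (1 / q ^ 4)) / sqrt s"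
        using q0 N0 st by (intro prob_sign_change_le j) (auto simp: divide_right_mono)
      also have "\<dots> \<le> 2 * (2 / q ^ 8) + (1 / q ^ 4 + 2 * (1 / q ^ 4)) / sqrt s"
      proof (intro add_mono mult_left_mono ex divide_right_mono order_refl)
        have "(A + 1 / q) / N - A / N = 1 / (q * N)" by (simp add: add_divide_distrib)
        also have "\<dots> \<le> 1 / q ^ 4"
          using Nq q N0 q4 by (intro divide_left_mono) (auto intro: order_trans[OF _ mult_mono[of 1 q "q ^ 4" N]])
        finally show "(A + 1 / q) / N - A / N \<le> 1 / q ^ 4" .
      qed (use st in auto)
      also have "\<dots> \<le> 4 * T / (q ^ 4 * sqrt s) + 3 * T / (q ^ 4 * sqrt s)"
      proof (intro add_mono)
        have "q ^ 4 * sqrt s \<le> q ^ 4 * T" using sqT[of s] st q0 by (intro mult_left_mono) auto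
        also have "\<dots> \<le> q ^ 8 * T" using q T by (intro mult_right_mono power_increasing) auto
        finally have "q ^ 4 * sqrt s \<le> q ^ 8 * T" .
        then show "2 * (2 / q ^ 8) \<le> 4 * T / (q ^ 4 * sqrt s)" using q0 st by (simp add: field_simps)
        show "(1 / q ^ 4 + 2 * (1 / q ^ 4)) / sqrt s \<le> 3 * T / (q ^ 4 * sqrt s)"
          using q0 st T by (simp add: field_simps)
      qed
      also have "\<dots> = V" by (simp add: V_def add_divide_distrib[symmetric])
      finally show "prob {\<omega> \<in> space M. (A / N < W j s \<omega>) \<noteq> ((A + 1 / q) / N < W j t \<omega>)} \<le> V" .
    qed
  qed
qed


section \<open>Increments of the scaled median over one step\<close>

lemma brownian_family_uminus: "brownian_family M (\<lambda>j t \<omega>. - W j t \<omega>) k"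
proof unfold_locales
  fix j assume "j \<in> {1..n}"
  from zero[OF this] show "AE \<omega> in M. - W j 0 \<omega> = 0" by simp
next
  fix j and s t :: real assume j: "j \<in> {1..n}" and st: "0 \<le> s" "s < t"
  from prob_normal_uminus[OF increment[OF this]] st
  show "distributed M lborel (\<lambda>\<omega>. - W j t \<omega> - - W j s \<omega>) (normal_density 0 (sqrt (t - s)))"
    by simp
next
  fix s t :: real assume st: "0 \<le> s" "0 \<le> t"
  show "indep_vars (\<lambda>_. borel \<Otimes>\<^sub>M borel) (\<lambda>j \<omega>. (- W j s \<omega>, - W j t \<omega>)) {1..n}"
    using indep_vars_compose2[OF indep[OF st], where Y = "\<lambda>_ (x, y). (- x, - y)" and N = "\<lambda>_. borel \<Otimes>\<^sub>M borel"]
    by simp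
qed

lemma X_uminus: "brownian_family.X (\<lambda>j t \<omega>. - W j t \<omega>) k t \<omega> = - X t \<omega>"
proof -
  interpret neg: brownian_family M "\<lambda>j t \<omega>. - W j t \<omega>" k by (rule brownian_family_uminus)
  show ?thesis by (simp only: neg.X_def X_def neg.med_def med_def median_uminus mult_minus_right)
qed

text \<open>The underlying bound saturates once the level reaches \<open>sqrt n\<close> standard
  deviations of the scaled process; \<open>b\<^sup>2\<close> stands for any value below both
  \<open>u\<^sup>2\<close> and this cap.\<close>

lemma prob_X_greater_le:
  assumes s: "s > 0" and u: "u \<ge> 0" and b: "b\<^sup>2 \<le> u\<^sup>2" "b\<^sup>2 \<le> real n"
  shows "prob {\<omega> \<in> space M. u * sqrt s < X s \<omega>} \<le> exp (- (c\<^sub>0\<^sup>2 * b\<^sup>2))"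
proof -
  define v where "v = u / sqrt (real n)"
  have v: "v \<ge> 0" "real n * v\<^sup>2 = u\<^sup>2" using u by (simp_all add: v_def power_divide)
  have "{\<omega> \<in> space M. u * sqrt s < X s \<omega>} = {\<omega> \<in> space M. v * sqrt s < med s \<omega>}"
    by (simp add: X_def v_def field_simps)
  also have "prob \<dots> \<le> exp (- (real n * (c\<^sub>0 * min v 1)\<^sup>2))"
    by (rule prob_med_greater_le[OF s v(1)])
  also have "b\<^sup>2 \<le> real n * (min v 1)\<^sup>2"
    using v b by (simp add: min_def)
  then have "c\<^sub>0\<^sup>2 * b\<^sup>2 \<le> c\<^sub>0\<^sup>2 * (real n * (min v 1)\<^sup>2)" by (rule mult_left_mono) simp
  then have "exp (- (real n * (c\<^sub>0 * min v 1)\<^sup>2)) \<le> exp (- (c\<^sub>0\<^sup>2 * b\<^sup>2))"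
    by (simp add: power_mult_distrib mult_ac)
  finally show ?thesis .
qed

text \<open>Unless \<open>X s\<close> leaves [-R, R], the next grid level above it is less than
  \<open>1 / q\<close> away. A rise of more than \<open>2 / q\<close> therefore crosses from that
  level to one \<open>1 / q\<close> higher, and a union bound over the grid gives the polynomial
  factor.\<close>

lemma prob_X_step_large_n:
  assumes q: "q \<ge> 2" and T: "T \<ge> 1" "s + 1 / q ^ 16 \<le> T" and s: "1 / q ^ 16 \<le> s"
    and n: "q ^ 8 \<le> real n"
  shows "prob {\<omega> \<in> space M. X s \<omega> + 2 / q < X (s + 1 / q ^ 16) \<omega>} \<le> 8 * T * q ^ 12 * exp (- (rate T * q\<^sup>2))"
proof -
  interpret neg: brownian_family M "\<lambda>j t \<omega>. - W j t \<omega>" k by (rule brownian_family_uminus)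
  define t where "t = s + 1 / q ^ 16"
  have q0: "q > 0" using q by simp
  have "1 / q ^ 16 > 0" using q0 by simp
  then have st: "s > 0" "s < t" "t \<le> T" "s \<le> T" using s T unfolding t_def by linarith+
  have [measurable]: "X s \<in> borel_measurable M" "X t \<in> borel_measurable M" using st by auto
  \<comment> \<open>The factor \<open>q ^ 4\<close> is the largest that
    \<open>prob_X_greater_le\<close> can exploit knowing only \<open>q ^ 8 \<le> n\<close>.\<close>
  define R where "R = q ^ 4 * sqrt s"
  define L where "L = nat \<lceil>2 * R * q ^ 8\<rceil>"
  \<comment> \<open>The spacing is \<open>1 / q ^ 8\<close> rather than \<open>1 / q\<close> because
    the top level may overshoot \<open>R\<close> by one spacing, and this excess must not exceed
    \<open>sqrt s\<close>, which can be as small as \<open>1 / q ^ 8\<close>.\<close>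
  define A where "A l = real l / q ^ 8 - R" for l :: nat
  have R0: "R \<ge> 0" using q0 st by (simp add: R_def)
  have L: "real L \<le> 2 * R * q ^ 8 + 1" using R0 q0 by (simp add: L_def)
  have A: "\<bar>A l\<bar> \<le> q ^ 4 * sqrt s + 1 / q ^ 8" if "l \<le> L" for l
  proof -
    have "real l / q ^ 8 \<le> real L / q ^ 8" using that q0 by (intro divide_right_mono) auto
    also have "\<dots> \<le> (2 * R * q ^ 8 + 1) / q ^ 8" using L q0 by (intro divide_right_mono) auto
    also have "\<dots> = 2 * R + 1 / q ^ 8" using q0 by (simp add: add_divide_distrib)
    finally have "real l / q ^ 8 \<le> 2 * R + 1 / q ^ 8" .
    moreover have "0 \<le> real l / q ^ 8" "0 \<le> 1 / q ^ 8" using q0 by simp_all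
    ultimately show ?thesis unfolding A_def R_def[symmetric] by linarith
  qed
  define E where "E l = {\<omega> \<in> space M. X s \<omega> \<le> A l \<and> A l + 1 / q < X t \<omega>}" for l
  define F where "F = {\<omega> \<in> space M. R < X s \<omega>} \<union> {\<omega> \<in> space M. R < - X s \<omega>}"
  have [measurable]: "E l \<in> events" "F \<in> events" for l unfolding E_def F_def by measurable
  have sub: "{\<omega> \<in> space M. X s \<omega> + 2 / q < X t \<omega>} \<subseteq> F \<union> (\<Union>l\<in>{..L}. E l)"
  proof
    fix \<omega> assume \<omega>: "\<omega> \<in> {\<omega> \<in> space M. X s \<omega> + 2 / q < X t \<omega>}"
    show "\<omega> \<in> F \<union> (\<Union>l\<in>{..L}. E l)"
    proof (cases "\<omega> \<in> F")
      case False
      then have x: "- R \<le> X s \<omega>" "X s \<omega> \<le> R" using \<omega> by (auto simp: F_def)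
      define y where "y = (X s \<omega> + R) * q ^ 8"
      define l where "l = nat \<lceil>y\<rceil>"
      have "y \<ge> 0" using x q0 by (simp add: y_def)
      then have ly: "y \<le> real l" "real l < y + 1" unfolding l_def by linarith+
      have "y \<le> 2 * R * q ^ 8" using x q0 by (simp add: y_def mult_right_mono)
      then have "l \<le> L" unfolding l_def L_def by (intro nat_mono ceiling_mono)
      have "X s \<omega> + R = y / q ^ 8" using q0 by (simp add: y_def)
      also have "\<dots> \<le> real l / q ^ 8" using ly q0 by (intro divide_right_mono) auto
      finally have 1: "X s \<omega> \<le> A l" by (simp add: A_def)
      have "real l / q ^ 8 < (y + 1) / q ^ 8" using ly q0 by (intro divide_strict_right_mono) auto
      also have "\<dots> = X s \<omega> + R + 1 / q ^ 8" using q0 by (simp add: y_def add_divide_distrib)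
      also have "1 / q ^ 8 \<le> 1 / q" using q power_increasing[of 1 8 q] by (intro divide_left_mono) auto
      finally have "A l < X s \<omega> + 1 / q" by (simp add: A_def)
      then have "A l + 1 / q < X t \<omega>" using \<omega> by simp
      then show ?thesis using 1 \<omega> \<open>l \<le> L\<close> by (auto simp: E_def)
    qed simp
  qed
  have rate8: "exp (- (c\<^sub>0\<^sup>2 * (q ^ 4)\<^sup>2)) \<le> exp (- (rate T * q\<^sup>2))"
  proof -
    have "rate T * q\<^sup>2 \<le> c\<^sub>0\<^sup>2 * (q ^ 4)\<^sup>2"
      using rate_le_c\<^sub>0[OF T(1)] power_increasing[of 2 8 q] q
      by (intro mult_mono) (auto simp flip: power_mult)
    then show ?thesis by simp
  qed
  have pF: "prob F \<le> 2 * exp (- (rate T * q\<^sup>2))"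
  proof -
    have nq: "(q ^ 4)\<^sup>2 \<le> real n" using n by (simp flip: power_mult)
    have q4: "0 \<le> q ^ 4" using q0 by simp
    have "prob F \<le> prob {\<omega> \<in> space M. R < X s \<omega>} + prob {\<omega> \<in> space M. R < - X s \<omega>}"
      unfolding F_def by (intro measure_Un_le) measurable
    also have "\<dots> \<le> exp (- (c\<^sub>0\<^sup>2 * (q ^ 4)\<^sup>2)) + exp (- (c\<^sub>0\<^sup>2 * (q ^ 4)\<^sup>2))"
      using prob_X_greater_le[OF st(1) q4 order_refl nq] neg.prob_X_greater_le[OF st(1) q4 order_refl nq]
      by (intro add_mono) (simp_all only: R_def X_uminus)
    finally show ?thesis using rate8 by linarith
  qed
  have pE: "prob (E l) \<le> exp (- (rate T * q\<^sup>2))" if "l \<le> L" for l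
    unfolding E_def t_def by (rule crossing_exponent[OF q T s n A[OF that]])
  have "prob {\<omega> \<in> space M. X s \<omega> + 2 / q < X t \<omega>} \<le> prob (F \<union> (\<Union>l\<in>{..L}. E l))"
    using sub by (intro finite_measure_mono) auto
  also have "\<dots> \<le> prob F + prob (\<Union>l\<in>{..L}. E l)"
    by (intro measure_Un_le) auto
  also have "prob (\<Union>l\<in>{..L}. E l) \<le> (\<Sum>l\<in>{..L}. prob (E l))"
    by (intro measure_UNION_le) auto
  also have "\<dots> \<le> (\<Sum>l\<in>{..L}. exp (- (rate T * q\<^sup>2)))" using pE by (intro sum_mono) auto
  also have "prob F + \<dots> \<le> (real L + 3) * exp (- (rate T * q\<^sup>2))"
    using pF by (simp add: algebra_simps)
  also have "\<dots> \<le> 8 * T * q ^ 12 * exp (- (rate T * q\<^sup>2))"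
  proof (intro mult_right_mono)
    have "sqrt s \<le> T"
      using st T by (intro real_le_lsqrt) (auto simp: power2_eq_square intro: order_trans[OF _ mult_mono[of 1 T T T]])
    then have "2 * R * q ^ 8 \<le> 2 * (q ^ 4 * T) * q ^ 8"
      unfolding R_def using q0 st T by (intro mult_right_mono mult_left_mono) auto
    also have "\<dots> = 2 * T * q ^ 12" by (simp add: mult_ac flip: power_add)
    finally have "real L \<le> 2 * T * q ^ 12 + 1" using L by simp
    moreover have "1 \<le> T * q ^ 12" using T one_le_power[of q 12] q mult_mono[of 1 T 1 "q ^ 12"] by simp
    ultimately show "real L + 3 \<le> 8 * T * q ^ 12" by linarith
  qed simp
  finally show ?thesis by (simp add: t_def)
qed

text \<open>Since \<open>X 0\<close> vanishes almost surely, the increment is a one-time value, and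
  \<open>2 / q\<close> is \<open>2 * q ^ 7\<close> times the root of the step length.\<close>

lemma prob_X_step_from_0_large_n:
  assumes q: "q \<ge> 2" and T: "T \<ge> 1" and n: "q ^ 8 \<le> real n"
  shows "prob {\<omega> \<in> space M. X 0 \<omega> + 2 / q < X (1 / q ^ 16) \<omega>} \<le> exp (- (rate T * q\<^sup>2))"
proof -
  have q0: "q > 0" using q by simp
  have "1 / q ^ 16 = (1 / q ^ 8)\<^sup>2" by (simp add: power_divide flip: power_mult)
  then have sq: "sqrt (1 / q ^ 16) = 1 / q ^ 8" using q0 by simp
  have "prob {\<omega> \<in> space M. X 0 \<omega> + 2 / q < X (1 / q ^ 16) \<omega>} =
      prob {\<omega> \<in> space M. 2 * q ^ 7 * sqrt (1 / q ^ 16) < X (1 / q ^ 16) \<omega>}"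
  proof (rule measure_eq_AE)
    show "AE \<omega> in M. (\<omega> \<in> {\<omega> \<in> space M. X 0 \<omega> + 2 / q < X (1 / q ^ 16) \<omega>}) =
        (\<omega> \<in> {\<omega> \<in> space M. 2 * q ^ 7 * sqrt (1 / q ^ 16) < X (1 / q ^ 16) \<omega>})"
      using med_0
    proof eventually_elim
      case (elim \<omega>)
      have "q ^ 8 = q ^ 7 * q" by (simp add: eval_nat_numeral)
      then have "2 * q ^ 7 * (1 / q ^ 8) = 2 / q" using q0 by (simp add: field_simps)
      then show ?case using elim unfolding sq by (simp add: X_def)
    qed
    have [measurable]: "X 0 \<in> borel_measurable M" "X (1 / q ^ 16) \<in> borel_measurable M"
      using q0 by auto
    show "{\<omega> \<in> space M. X 0 \<omega> + 2 / q < X (1 / q ^ 16) \<omega>} \<in> events"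
      "{\<omega> \<in> space M. 2 * q ^ 7 * sqrt (1 / q ^ 16) < X (1 / q ^ 16) \<omega>} \<in> events" by measurable
  qed
  also have "\<dots> \<le> exp (- (c\<^sub>0\<^sup>2 * q\<^sup>2))"
  proof (rule prob_X_greater_le)
    have "q \<le> 2 * q ^ 7" using q power_increasing[of 1 7 q] by simp
    then show "q\<^sup>2 \<le> (2 * q ^ 7)\<^sup>2" using q0 by (intro power_mono) auto
    show "q\<^sup>2 \<le> real n" using n power_increasing[of 2 8 q] q by linarith
  qed (use q0 in auto)
  also have "\<dots> \<le> exp (- (rate T * q\<^sup>2))"
  proof -
    have "rate T * q\<^sup>2 \<le> c\<^sub>0\<^sup>2 * q\<^sup>2" using rate_le_c\<^sub>0[OF T] by (intro mult_right_mono) auto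
    then show ?thesis by simp
  qed
  finally show ?thesis .
qed

text \<open>Some single motion must move by more than \<open>e = 2 / (q * sqrt n)\<close>. Its
  Gaussian exponent is \<open>2 * q ^ 14 / n\<close>, well above \<open>q\<^sup>2\<close>, and the
  union bound costs only \<open>2 * n < 2 * q ^ 8\<close>.\<close>

lemma prob_X_step_small_n:
  assumes q: "q \<ge> 2" and T: "T \<ge> 1" and s: "0 \<le> s" and n: "real n < q ^ 8"
  shows "prob {\<omega> \<in> space M. X s \<omega> + 2 / q < X (s + 1 / q ^ 16) \<omega>} \<le> 2 * q ^ 8 * exp (- (rate T * q\<^sup>2))"
proof -
  define t where "t = s + 1 / q ^ 16"
  define e where "e = 2 / (q * sqrt (real n))"
  have q0: "q > 0" using q by simp
  have st: "s < t" "t - s = 1 / q ^ 16" using q0 by (auto simp: t_def)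
  have [measurable]: "med s \<in> borel_measurable M" "med t \<in> borel_measurable M" using s st by auto
  have "prob {\<omega> \<in> space M. X s \<omega> + 2 / q < X t \<omega>} \<le> prob {\<omega> \<in> space M. e < \<bar>med t \<omega> - med s \<omega>\<bar>}"
  proof (intro finite_measure_mono subsetI)
    fix \<omega> assume \<omega>: "\<omega> \<in> {\<omega> \<in> space M. X s \<omega> + 2 / q < X t \<omega>}"
    then have "2 / q < sqrt (real n) * (med t \<omega> - med s \<omega>)" by (simp add: X_def algebra_simps)
    then have "2 / q / sqrt (real n) < sqrt (real n) * (med t \<omega> - med s \<omega>) / sqrt (real n)"
      by (intro divide_strict_right_mono) auto
    then have "e < med t \<omega> - med s \<omega>" by (simp add: e_def)
    then show "\<omega> \<in> {\<omega> \<in> space M. e < \<bar>med t \<omega> - med s \<omega>\<bar>}" using \<omega> by simp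
  qed measurable
  also have "\<dots> \<le> 2 * real n * exp (- (e\<^sup>2 / (2 * (t - s))))"
    using q0 by (intro prob_med_diff_greater_le s st) (simp add: e_def)
  also have "\<dots> \<le> 2 * q ^ 8 * exp (- (rate T * q\<^sup>2))"
  proof (intro mult_mono exp_le_cancel_iff[THEN iffD2] le_imp_neg_le)
    have "rate T * q\<^sup>2 \<le> 1 * q\<^sup>2" using rate_le_1[OF T] by (intro mult_right_mono) auto
    also have "\<dots> \<le> q ^ 6" using q by (simp add: power_increasing)
    also have "\<dots> = q ^ 14 / q ^ 8" using q0 by (simp add: field_simps flip: power_add)
    also have "\<dots> \<le> q ^ 14 / real n" using n q0 by (intro divide_left_mono) auto
    also have "\<dots> \<le> 2 * q ^ 14 / real n" using q0 by (intro divide_right_mono) auto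
    also have "\<dots> = e\<^sup>2 / (2 * (t - s))"
    proof -
      have "e\<^sup>2 = 4 / (q\<^sup>2 * real n)" by (simp add: e_def power_divide power_mult_distrib)
      then have "e\<^sup>2 / (2 * (t - s)) = 2 * q ^ 16 / (q\<^sup>2 * real n)" unfolding st(2) by simp
      also have "2 * q ^ 16 = q\<^sup>2 * (2 * q ^ 14)" by (simp flip: power_add)
      also have "q\<^sup>2 * (2 * q ^ 14) / (q\<^sup>2 * real n) = 2 * q ^ 14 / real n"
        using q0 by (intro nonzero_mult_divide_mult_cancel_left) simp
      finally show ?thesis by simp
    qed
    finally show "rate T * q\<^sup>2 \<le> e\<^sup>2 / (2 * (t - s))" .
  qed (use n in auto)
  finally show ?thesis by (simp add: t_def)
qed

text \<open>The condition on \<open>s\<close> is the one met by dyadic grid points when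
  \<open>q ^ 16 = 2 ^ m\<close>: a step starts either at 0 or at least one step length away from
  it.\<close>

lemma prob_X_step_upper:
  assumes q: "q \<ge> 2" and T: "T \<ge> 1" "s + 1 / q ^ 16 \<le> T" and s: "s = 0 \<or> 1 / q ^ 16 \<le> s"
  shows "prob {\<omega> \<in> space M. X s \<omega> + 2 / q < X (s + 1 / q ^ 16) \<omega>} \<le> 8 * T * q ^ 12 * exp (- (rate T * q\<^sup>2))"
proof -
  have "1 / q ^ 16 \<ge> 0" using q by simp
  then have s0: "s \<ge> 0" using s by linarith
  have q12: "1 \<le> q ^ 12" "q ^ 8 \<le> q ^ 12" 
    using q one_le_power[of q 12] power_increasing[of 8 12 q] by simp_all
  have "1 * q ^ 12 \<le> T * q ^ 12" using T q by (intro mult_right_mono) auto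
  then have Tq: "1 \<le> 8 * T * q ^ 12" "2 * q ^ 8 \<le> 8 * T * q ^ 12" using q12 by linarith+
  consider "real n < q ^ 8" | "q ^ 8 \<le> real n" "s = 0" | "q ^ 8 \<le> real n" "1 / q ^ 16 \<le> s"
    using s by linarith
  then show ?thesis
  proof cases
    case 1
    note prob_X_step_small_n[OF q T(1) s0 1]
    also have "2 * q ^ 8 * exp (- (rate T * q\<^sup>2)) \<le> 8 * T * q ^ 12 * exp (- (rate T * q\<^sup>2))"
      by (intro mult_right_mono Tq) simp
    finally show ?thesis .
  next
    case 2
    have "prob {\<omega> \<in> space M. X s \<omega> + 2 / q < X (s + 1 / q ^ 16) \<omega>} \<le> 1 * exp (- (rate T * q\<^sup>2))"
      using prob_X_step_from_0_large_n[OF q T(1) 2(1)] 2(2) by simp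
    also have "\<dots> \<le> 8 * T * q ^ 12 * exp (- (rate T * q\<^sup>2))" using Tq by (intro mult_right_mono) auto
    finally show ?thesis .
  next
    case 3
    then show ?thesis using prob_X_step_large_n[OF q T] by simp
  qed
qed

lemma prob_X_step:
  assumes q: "q \<ge> 2" and T: "T \<ge> 1" "s + 1 / q ^ 16 \<le> T" and s: "s = 0 \<or> 1 / q ^ 16 \<le> s"
  shows "prob {\<omega> \<in> space M. 2 / q < \<bar>X (s + 1 / q ^ 16) \<omega> - X s \<omega>\<bar>} \<le> 16 * T * q ^ 12 * exp (- (rate T * q\<^sup>2))"
proof -
  interpret neg: brownian_family M "\<lambda>j t \<omega>. - W j t \<omega>" k by (rule brownian_family_uminus)
  define t where "t = s + 1 / q ^ 16"
  have "1 / q ^ 16 \<ge> 0" using q by simp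
  then have "s \<ge> 0" "t \<ge> 0" using s unfolding t_def by linarith+
  then have [measurable]: "X s \<in> borel_measurable M" "X t \<in> borel_measurable M" by auto
  have eq: "{\<omega> \<in> space M. 2 / q < \<bar>X t \<omega> - X s \<omega>\<bar>} =
      {\<omega> \<in> space M. X s \<omega> + 2 / q < X t \<omega>} \<union> {\<omega> \<in> space M. - X s \<omega> + 2 / q < - X t \<omega>}"
    by auto
  have "prob {\<omega> \<in> space M. 2 / q < \<bar>X t \<omega> - X s \<omega>\<bar>} \<le>
      prob {\<omega> \<in> space M. X s \<omega> + 2 / q < X t \<omega>} + prob {\<omega> \<in> space M. - X s \<omega> + 2 / q < - X t \<omega>}"
    unfolding eq by (intro measure_Un_le) measurable
  also have "\<dots> \<le> 8 * T * q ^ 12 * exp (- (rate T * q\<^sup>2)) + 8 * T * q ^ 12 * exp (- (rate T * q\<^sup>2))"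
    using prob_X_step_upper[OF assms] neg.prob_X_step_upper[OF assms, unfolded X_uminus]
    unfolding t_def by (rule add_mono)
  finally show ?thesis by (simp add: t_def)
qed

end

section \<open>Chaining and compactness\<close>

text \<open>Each point is approximated from below by its dyadic truncations \<open>d j x\<close>.
  Telescoping along them costs \<open>S\<close> for each of the two points, and the truncations at
  level \<open>m\<close> are equal or adjacent, which costs \<open>b m\<close>.\<close>

lemma dyadic_chaining:
  fixes f :: "real \<Rightarrow> real" and b :: "nat \<Rightarrow> real" and T :: nat
  assumes cont: "continuous_on {0..real T} f"
    and step: "\<And>m i. m \<ge> m0 \<Longrightarrow> i < T * 2 ^ m \<Longrightarrow> \<bar>f ((real i + 1) / 2 ^ m) - f (real i / 2 ^ m)\<bar> \<le> b m"
    and b: "summable b" "\<And>m. b m \<ge> 0"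
    and m: "m \<ge> m0" and st: "s \<in> {0..real T}" "t \<in> {0..real T}" "\<bar>s - t\<bar> \<le> 1 / 2 ^ m"
  shows "\<bar>f s - f t\<bar> \<le> 2 * (\<Sum>j. b (j + m))"
proof -
  define n where "n j x = nat \<lfloor>x * 2 ^ j\<rfloor>" for j and x :: real
  define d where "d j x = real (n j x) / 2 ^ j" for j x
  have n: "real (n j x) \<le> x * 2 ^ j" "x * 2 ^ j < real (n j x) + 1" if "x \<ge> 0" for j x
    using that by (auto simp: n_def)
  have d_le: "d j x \<le> x" "x < d j x + 1 / 2 ^ j" "0 \<le> d j x" if "x \<ge> 0" for j x
    using n[OF that, of j] by (auto simp: d_def field_simps)
  define S where "S = (\<Sum>j. b (Suc j + m))"
  have sb: "summable (\<lambda>j. b (j + m))" "summable (\<lambda>j. b (Suc j + m))"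
    using summable_ignore_initial_segment[OF b(1), of m]
      summable_ignore_initial_segment[OF b(1), of "Suc m"] by simp_all
  \<comment> \<open>Passing to the next level appends one binary digit: the truncation stays put or
    moves by one step of the finer grid.\<close>
  have one: "\<bar>f (d (Suc j) x) - f (d j x)\<bar> \<le> b (Suc j)" if j: "j \<ge> m0" and x: "x \<in> {0..real T}" for j x
  proof -
    have x0: "x \<ge> 0" using x by simp
    have "real (2 * n j x) < real (n (Suc j) x) + 1" "real (n (Suc j) x) < real (2 * n j x + 2)"
      using n[OF x0, of j] n[OF x0, of "Suc j"] by auto
    then have "2 * n j x < n (Suc j) x + 1" "n (Suc j) x < 2 * n j x + 2"
      by linarith+
    then consider "n (Suc j) x = 2 * n j x" | "n (Suc j) x = 2 * n j x + 1" by linarith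
    then show ?thesis
    proof cases
      case 1
      then have "d (Suc j) x = d j x" by (simp add: d_def)
      then show ?thesis using b(2) by simp
    next
      case 2
      have "real (2 * n j x + 1) \<le> x * 2 ^ Suc j" using n[OF x0, of "Suc j"] 2 by simp
      also have "\<dots> \<le> real T * 2 ^ Suc j" using x by (intro mult_right_mono) auto
      also have "\<dots> = real (T * 2 ^ Suc j)" by simp
      finally have "2 * n j x + 1 \<le> T * 2 ^ Suc j" by (simp only: of_nat_le_iff)
      then have "2 * n j x < T * 2 ^ Suc j" by linarith
      from step[OF _ this] j 2 show ?thesis by (simp add: d_def add_ac)
    qed
  qed
  have far: "\<bar>f x - f (d m x)\<bar> \<le> S" if x: "x \<in> {0..real T}" for x
  proof -
    have part: "\<bar>f (d (N + m) x) - f (d m x)\<bar> \<le> (\<Sum>j<N. b (Suc j + m))" for N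
    proof (induction N)
      case (Suc N)
      then show ?case using one[of "N + m" x] m x by simp
    qed simp
    have "(\<lambda>N. d (N + m) x) \<longlonglongrightarrow> x"
    proof (rule tendsto_sandwich[OF always_eventually always_eventually])
      show "\<forall>N. x - (1 / 2) ^ (N + m) \<le> d (N + m) x"
        using d_le(2)[of x] x by (simp add: power_one_over inverse_eq_divide algebra_simps less_imp_le)
      show "\<forall>N. d (N + m) x \<le> x" using d_le(1) x by simp
      have "(\<lambda>N. x - (1 / 2) ^ (N + m)) \<longlonglongrightarrow> x - 0"
        by (intro tendsto_intros LIMSEQ_ignore_initial_segment LIMSEQ_realpow_zero) auto
      then show "(\<lambda>N. x - (1 / 2) ^ (N + m)) \<longlonglongrightarrow> x" by simp
    qed simp
    moreover have "d j x \<in> {0..real T}" for j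
      using d_le[of x j] x by auto
    ultimately have "(\<lambda>N. f (d (N + m) x)) \<longlonglongrightarrow> f x"
      by (intro continuous_on_tendsto_compose[OF cont _ x]) auto
    then have "(\<lambda>N. \<bar>f (d (N + m) x) - f (d m x)\<bar>) \<longlonglongrightarrow> \<bar>f x - f (d m x)\<bar>"
      by (intro tendsto_intros)
    moreover have "\<bar>f (d (N + m) x) - f (d m x)\<bar> \<le> S" for N
      using part[of N] sum_le_suminf[OF sb(2), of "{..<N}"] b(2) unfolding S_def by force
    ultimately show ?thesis by (intro LIMSEQ_le_const2) auto
  qed
  have near: "\<bar>f (d m s) - f (d m t)\<bar> \<le> b m"
    if st: "s \<in> {0..real T}" "t \<in> {0..real T}" "s \<le> t" "t - s \<le> 1 / 2 ^ m" for s t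
  proof -
    have "t * 2 ^ m - s * 2 ^ m \<le> 1"
      using st(4) by (simp add: field_simps)
    moreover have "s * 2 ^ m \<le> t * 2 ^ m" using st(3) by simp
    moreover have "real (n m s) \<le> s * 2 ^ m" "s * 2 ^ m < real (n m s) + 1"
      "real (n m t) \<le> t * 2 ^ m" "t * 2 ^ m < real (n m t) + 1"
      using n[of s m] n[of t m] st(1,2) by simp_all
    ultimately have "real (n m t) < real (n m s) + 2" "real (n m s) < real (n m t) + 1"
      by linarith+
    then consider "n m t = n m s" | "n m t = n m s + 1" by linarith
    then show ?thesis
    proof cases
      case 1
      then show ?thesis using b(2) by (simp add: d_def)
    next
      case 2
      have "real (n m s + 1) \<le> t * 2 ^ m" using n[of t m] st(2) 2 by simp
      also have "\<dots> \<le> real T * 2 ^ m" using st by (intro mult_right_mono) auto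
      also have "\<dots> = real (T * 2 ^ m)" by simp
      finally have "n m s + 1 \<le> T * 2 ^ m" by (simp only: of_nat_le_iff)
      then have "n m s < T * 2 ^ m" by linarith
      from step[OF m this] 2 show ?thesis by (simp add: d_def abs_minus_commute add_ac)
    qed
  qed
  have "\<bar>f (d m s) - f (d m t)\<bar> \<le> b m"
    using near[OF st(1,2)] near[OF st(2,1)] st(3) by (cases "s \<le> t") (auto simp: abs_minus_commute)
  then have "\<bar>f s - f t\<bar> \<le> b m + 2 * S"
    using far[OF st(1)] far[OF st(2)] by linarith
  also have "\<dots> \<le> 2 * (\<Sum>j. b (j + m))"
    using suminf_split_head[OF sb(1)] b(2)[of m] by (simp add: S_def)
  finally show ?thesis .
qed

section \<open>Compactness from a common modulus of continuity\<close>

lemma abs_le_of_modulus: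
  fixes g :: "real \<Rightarrow> real"
  assumes g0: "g 0 = 0" and d: "d > 0" and x: "x \<in> {0..c}"
    and mod: "\<And>s t. s \<in> {0..c} \<Longrightarrow> t \<in> {0..c} \<Longrightarrow> \<bar>s - t\<bar> \<le> d \<Longrightarrow> \<bar>g s - g t\<bar> \<le> w"
  shows "\<bar>g x\<bar> \<le> (real (nat \<lceil>x / d\<rceil>) + 1) * w"
proof -
  \<comment> \<open>The path is followed from 0 to \<open>x\<close> in \<open>L\<close> equal steps
    of length at most \<open>d\<close>; the added 1 keeps \<open>L\<close> positive when
    \<open>x = 0\<close>.\<close>
  define L where "L = nat \<lceil>x / d\<rceil> + 1"
  have L: "x / d \<le> real L" "L > 0" unfolding L_def by linarith+
  have "\<bar>g (real i * (x / real L))\<bar> \<le> real i * w" if "i \<le> L" for i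
    using that
  proof (induction i)
    case 0
    then show ?case using g0 by simp
  next
    case (Suc i)
    have le: "real j * (x / real L) \<le> x" if "j \<le> L" for j
      using L(2) x that by (simp add: field_simps mult_left_mono)
    have "\<bar>g (real (Suc i) * (x / real L)) - g (real i * (x / real L))\<bar> \<le> w"
    proof (rule mod)
      show "\<bar>real (Suc i) * (x / real L) - real i * (x / real L)\<bar> \<le> d"
        using L x d by (simp add: field_simps)
      show "real (Suc i) * (x / real L) \<in> {0..c}" "real i * (x / real L) \<in> {0..c}"
        using le[of i] le[of "Suc i"] Suc.prems x by auto
    qed
    then show ?case using Suc by (simp add: algebra_simps)
  qed
  from this[of L] show ?thesis using L(2) by (simp add: L_def add.commute)
qed

text \<open>Arzela-Ascoli by way of Tychonoff: the set is first seen to be compact for pointwise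
  convergence, as a closed part of a product of compact intervals. Equicontinuity makes
  \<open>Abs_cpath\<close> continuous on it for the finer topology, and a continuous image of a
  compact set is compact.\<close>

lemma compact_cpath_modulus:
  fixes N :: "nat \<Rightarrow> nat" and d w :: "nat \<Rightarrow> real"
  assumes d: "\<And>m. d m > 0" and w: "w \<longlonglongrightarrow> 0"
  shows "compact {f. path_at f 0 = 0 \<and> (\<forall>T. \<forall>m\<ge>N T. \<forall>s\<in>{0..real T}. \<forall>t\<in>{0..real T}.
    \<bar>s - t\<bar> \<le> d m \<longrightarrow> \<bar>path_at f s - path_at f t\<bar> \<le> w m)}" (is "compact ?K")
proof -
  define P where "P g \<longleftrightarrow> g 0 = 0 \<and> (\<forall>T. \<forall>m\<ge>N T. \<forall>s\<in>{0..real T}. \<forall>t\<in>{0..real T}.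
    \<bar>s - t\<bar> \<le> d m \<longrightarrow> \<bar>g s - g t\<bar> \<le> w m)" for g :: "real \<Rightarrow> real"
  \<comment> \<open>The bound of \<open>abs_le_of_modulus\<close> at the first level that controls
    the horizon \<open>nat \<lceil>x\<rceil>\<close>.\<close>
  define R where "R x = (real (nat \<lceil>x / d (N (nat \<lceil>x\<rceil>))\<rceil>) + 1) * w (N (nat \<lceil>x\<rceil>))" for x :: real
  \<comment> \<open>Representatives of paths are extensional, hence \<open>undefined\<close> at
    negative times; the singleton factor encodes this.\<close>
  define B where "B x = (if x < 0 then {undefined} else {- R x..R x})" for x :: real
  define K where "K = PiE UNIV B \<inter> {g. P g}"
  have "compactin (product_topology (\<lambda>_. euclidean) UNIV) (PiE UNIV B)"
    by (subst compactin_PiE) (auto simp: B_def compactin_euclidean_iff)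
  then have "compact (PiE UNIV B)"
    by (simp add: euclidean_product_topology compactin_euclidean_iff)
  moreover have "closed {g. P g}"
    unfolding P_def Ball_def
    by (intro closed_Collect_conj closed_Collect_all closed_Collect_imp closed_Collect_eq
        closed_Collect_le continuous_intros open_Collect_const continuous_on_product_coordinates)
  ultimately have "compact K" unfolding K_def by (rule compact_Int_closed)
  have equi: "\<exists>e>0. \<forall>g s t. P g \<longrightarrow> s \<in> {0..real T} \<longrightarrow> t \<in> {0..real T} \<longrightarrow> \<bar>s - t\<bar> \<le> e \<longrightarrow> \<bar>g s - g t\<bar> < r"
    if "r > 0" for r T
  proof -
    have "eventually (\<lambda>m. w m < r) sequentially" using w that by (rule order_tendstoD)
    moreover have "eventually (\<lambda>m. m \<ge> N T) sequentially" by (rule eventually_ge_at_top)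
    ultimately have "eventually (\<lambda>m. w m < r \<and> m \<ge> N T) sequentially" by eventually_elim simp
    then obtain m where m: "w m < r" "m \<ge> N T" unfolding eventually_sequentially by blast
    have "\<bar>g s - g t\<bar> < r"
      if g: "P g" and st: "s \<in> {0..real T}" "t \<in> {0..real T}" "\<bar>s - t\<bar> \<le> d m" for g s t
    proof -
      have "\<bar>g s - g t\<bar> \<le> w m" using g m(2) st unfolding P_def by blast
      then show ?thesis using m(1) by simp
    qed
    then show ?thesis using d[of m] by blast
  qed
  have cont: "continuous_on {0..} g" if Pg: "P g" for g
  proof (unfold continuous_on_iff, intro ballI allI impI)
    fix x r :: real assume x: "x \<in> {0..}" and r: "r > 0"
    define T where "T = nat \<lceil>x + 1\<rceil>"
    have T: "x + 1 \<le> real T" unfolding T_def by linarith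
    obtain e where "e > 0" and e: "\<And>s t. s \<in> {0..real T} \<Longrightarrow> t \<in> {0..real T} \<Longrightarrow> \<bar>s - t\<bar> \<le> e \<Longrightarrow> \<bar>g s - g t\<bar> < r"
      using equi[OF r, of T] Pg by blast
    show "\<exists>e>0. \<forall>y\<in>{0..}. dist y x < e \<longrightarrow> dist (g y) (g x) < r"
    proof (intro exI[of _ "min e 1"] conjI ballI impI)
      fix y :: real assume "y \<in> {0..}" "dist y x < min e 1"
      then show "dist (g y) (g x) < r"
        using x T by (auto simp: dist_real_def intro!: e)
    qed (use \<open>e > 0\<close> in auto)
  qed
  have dom: "g \<in> {f. continuous_on {0..} f \<and> f \<in> extensional {0..}}" if "g \<in> K" for g
    using that cont[of g] by (auto simp: K_def B_def extensional_def PiE_iff split: if_splits)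
  have "continuous_on K Abs_cpath"
    unfolding continuous_on_topological
  proof (intro ballI allI impI)
    fix g U assume g: "g \<in> K" and U: "open U" "Abs_cpath g \<in> U"
    obtain L r where L: "compact L" "L \<subseteq> {0..}" "r > 0"
      "{h. \<forall>t\<in>L. dist (path_at h t) (path_at (Abs_cpath g) t) < r} \<subseteq> U"
      using U(1)[unfolded open_cpath_def, rule_format, OF U(2)] by blast
    obtain C where C: "\<And>x. x \<in> L \<Longrightarrow> norm x \<le> C" using compact_imp_bounded[OF L(1)]
      unfolding bounded_iff by blast
    define T where "T = nat \<lceil>C\<rceil> + 1"
    have T: "L \<subseteq> {0..real T}"
    proof
      fix x assume "x \<in> L"
      then have "x \<ge> 0" "x \<le> C" using L(2) C[of x] by auto
      then show "x \<in> {0..real T}" unfolding T_def by simp linarith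
    qed
    obtain e where "e > 0" and e: "\<And>g s t. P g \<Longrightarrow> s \<in> {0..real T} \<Longrightarrow> t \<in> {0..real T} \<Longrightarrow> \<bar>s - t\<bar> \<le> e \<Longrightarrow> \<bar>g s - g t\<bar> < r / 3"
      using equi[of "r / 3" T] L(3) by auto
    define k where "k = nat \<lceil>real T / e\<rceil>"
    \<comment> \<open>Closeness at finitely many grid points of mesh \<open>e\<close> is open for
      pointwise convergence; with both moduli below \<open>r / 3\<close> it forces distance below
      \<open>r\<close> on all of \<open>L\<close>. The \<open>min\<close> keeps the last grid point
      within the horizon.\<close>
    define A where "A = (\<Inter>i\<in>{..k}. {h. \<bar>h (min (real i * e) (real T)) - g (min (real i * e) (real T))\<bar> < r / 3})"
    have "open A" unfolding A_def
      by (intro open_INT finite_atMost ballI open_Collect_less continuous_intros continuous_on_product_coordinates)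
    moreover have "g \<in> A" using L(3) by (simp add: A_def)
    moreover have "Abs_cpath h \<in> U" if h: "h \<in> K" "h \<in> A" for h
    proof -
      have "\<bar>h t - g t\<bar> < r" if t: "t \<in> L" for t
      proof -
        have tT: "0 \<le> t" "t \<le> real T" using t T by auto
        define i where "i = nat \<lfloor>t / e\<rfloor>"
        have "real i \<le> t / e" "t / e < real i + 1" using tT \<open>e > 0\<close> by (simp_all add: i_def)
        then have i: "real i * e \<le> t" "t < real i * e + e" using \<open>e > 0\<close> by (simp_all add: field_simps)
        have "t / e \<le> real T / e" using tT \<open>e > 0\<close> by (simp add: divide_right_mono)
        then have "i \<le> k" unfolding i_def k_def by linarith
        then have 1: "\<bar>h (real i * e) - g (real i * e)\<bar> < r / 3"
          using h(2) i tT by (auto simp: A_def min_def split: if_splits)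
        have "real i * e \<in> {0..real T}" "t \<in> {0..real T}" "\<bar>real i * e - t\<bar> \<le> e"
          using i tT \<open>e > 0\<close> by auto
        note close = e[OF _ this, of g] e[OF _ this, of h]
        have "\<bar>g (real i * e) - g t\<bar> < r / 3" "\<bar>h (real i * e) - h t\<bar> < r / 3"
          using close g h(1) by (simp_all add: K_def)
        then show ?thesis using 1 by linarith
      qed
      then have "\<forall>t\<in>L. dist (path_at (Abs_cpath h) t) (path_at (Abs_cpath g) t) < r"
        by (simp add: Abs_cpath_inverse[OF dom[OF h(1)]] Abs_cpath_inverse[OF dom[OF g]] dist_real_def)
      then show ?thesis using L(4) by blast
    qed
    ultimately show "\<exists>A. open A \<and> g \<in> A \<and> (\<forall>h\<in>K. h \<in> A \<longrightarrow> Abs_cpath h \<in> U)" by blast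
  qed
  then have "compact (Abs_cpath ` K)" using \<open>compact K\<close> by (rule compact_continuous_image)
  moreover have "?K = Abs_cpath ` K"
  proof
    show "Abs_cpath ` K \<subseteq> ?K"
    proof
      fix f assume "f \<in> Abs_cpath ` K"
      then obtain g where g: "g \<in> K" "f = Abs_cpath g" by blast
      then have "path_at f = g" using Abs_cpath_inverse[OF dom] by simp
      then show "f \<in> ?K" using g(1) by (simp add: K_def P_def)
    qed
    show "?K \<subseteq> Abs_cpath ` K"
    proof
      fix f assume "f \<in> ?K"
      then have P: "P (path_at f)" by (simp add: P_def)
      have "path_at f x \<in> B x" for x
      proof (cases "x < 0")
        case True
        then show ?thesis using path_at[of f] by (auto simp: B_def extensional_def)
      next
        case False
        define T where "T = nat \<lceil>x\<rceil>"
        have "x \<in> {0..real T}" using False unfolding T_def by simp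
        moreover have "\<bar>path_at f s - path_at f t\<bar> \<le> w (N T)"
          if "s \<in> {0..real T}" "t \<in> {0..real T}" "\<bar>s - t\<bar> \<le> d (N T)" for s t
          using P that unfolding P_def by blast
        moreover have "path_at f 0 = 0" using P unfolding P_def by blast
        ultimately have "\<bar>path_at f x\<bar> \<le> (real (nat \<lceil>x / d (N T)\<rceil>) + 1) * w (N T)"
          using abs_le_of_modulus[of "path_at f" "d (N T)" x "real T" "w (N T)"] d by blast
        then show ?thesis using False by (auto simp: B_def R_def T_def abs_le_iff)
      qed
      then have "path_at f \<in> K" using P by (auto simp: K_def)
      then show "f \<in> Abs_cpath ` K" using path_at_inverse by (metis imageI)
    qed
  qed
  ultimately show ?thesis by simp
qed

section \<open>Measurability of path-valued maps\<close>

text \<open>Rationals are dense in a nondegenerate interval, and continuity carries the closed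
  bounds to the closure.\<close>

lemma bounds_from_Rats:
  fixes g :: "real \<Rightarrow> real"
  assumes g: "continuous_on {a..b} g" and ab: "a < b"
    and Q: "\<And>t. t \<in> \<rat> \<Longrightarrow> t \<in> {a..b} \<Longrightarrow> g t \<in> {c..d}" and t: "t \<in> {a..b}"
  shows "g t \<in> {c..d}"
proof -
  have "{a..b} \<subseteq> closure ({a..b} \<inter> \<rat>)"
  proof -
    have "{a..b} = closure {a<..<b}" using ab by simp
    also have "\<dots> \<subseteq> closure ({a<..<b} \<inter> \<rat>)"
      using open_Int_closure_subset[of "{a<..<b}" "\<rat>"] Rats_closure_real
      by (intro closure_minimal) auto
    also have "\<dots> \<subseteq> closure ({a..b} \<inter> \<rat>)" by (intro closure_mono) auto
    finally show ?thesis .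
  qed
  moreover have "closure ({a..b} \<inter> \<rat>) \<subseteq> {a..b}" by (intro closure_minimal) auto
  ultimately have cl: "closure ({a..b} \<inter> \<rat>) = {a..b}" by blast
  have "g ` closure ({a..b} \<inter> \<rat>) \<subseteq> {c..d}"
    using g Q by (intro image_closure_subset) (auto simp: cl)
  then have "g ` {a..b} \<subseteq> {c..d}" by (simp only: cl)
  then show ?thesis using t by blast
qed

text \<open>
  Boxes made of finitely many rational rectangles over a uniform partition form a countable family
  from which every open set of paths is a union. This replaces a separability argument.
\<close>

definition path_box :: "nat \<Rightarrow> (rat \<times> rat) list \<Rightarrow> cpath set" where
  "path_box k l = {g. \<forall>i<length l. \<forall>t\<in>{real i / Suc k..(real i + 1) / Suc k}.
     path_at g t \<in> {of_rat (fst (l ! i))..of_rat (snd (l ! i))}}"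

lemma open_cpath_path_box:
  assumes U: "open U" "f \<in> U"
  shows "\<exists>k l. f \<in> path_box k l \<and> path_box k l \<subseteq> U"
proof -
  obtain L e where L: "compact L" "L \<subseteq> {0..}" "e > 0"
    "{h. \<forall>t\<in>L. dist (path_at h t) (path_at f t) < e} \<subseteq> U"
    using U(1)[unfolded open_cpath_def, rule_format, OF U(2)] by blast
  obtain C where C: "\<And>x. x \<in> L \<Longrightarrow> norm x \<le> C" using compact_imp_bounded[OF L(1)]
    unfolding bounded_iff by blast
  \<comment> \<open>The added 1 makes \<open>x < T\<close> strict on \<open>L\<close>, so that the
    cell index of every point of \<open>L\<close> is below \<open>T * Suc k\<close>.\<close>
  define T where "T = nat \<lceil>C\<rceil> + 1"
  have T: "0 \<le> x" "x < real T" if "x \<in> L" for x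
  proof -
    have "x \<ge> 0" "x \<le> C" using L(2) C[of x] that by auto
    then show "0 \<le> x" "x < real T" unfolding T_def by linarith+
  qed
  have "uniformly_continuous_on {0..real T} (path_at f)"
    by (intro compact_uniformly_continuous continuous_on_path_at) auto
  from uniformly_continuous_onE[OF this, of "e / 4"] L(3) obtain \<delta> where
    \<delta>: "\<delta> > 0" "\<And>s t. s \<in> {0..real T} \<Longrightarrow> t \<in> {0..real T} \<Longrightarrow> dist s t < \<delta> \<Longrightarrow> dist (path_at f s) (path_at f t) < e / 4"
    by (metis zero_less_divide_iff zero_less_numeral)
  obtain k where k: "1 / real (Suc k) < \<delta>"
    using nat_approx_posE[OF \<delta>(1)] by auto
  \<comment> \<open>On a cell \<open>f\<close> varies by less than \<open>e / 4\<close>. Bounds at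
    distance between \<open>e / 4\<close> and \<open>e / 2\<close> from its value at the left end
    thus contain \<open>f\<close>, and keep every path in the box within \<open>3 * e / 4\<close> of
    \<open>f\<close>.\<close>
  have "\<forall>i. \<exists>q::rat \<times> rat. path_at f (real i / Suc k) - e / 2 < of_rat (fst q) \<and>
      of_rat (fst q) < path_at f (real i / Suc k) - e / 4 \<and>
      path_at f (real i / Suc k) + e / 4 < of_rat (snd q) \<and>
      of_rat (snd q) < path_at f (real i / Suc k) + e / 2"
  proof
    fix i
    obtain a b :: rat where
      "path_at f (real i / Suc k) - e / 2 < of_rat a" "of_rat a < path_at f (real i / Suc k) - e / 4"
      "path_at f (real i / Suc k) + e / 4 < of_rat b" "of_rat b < path_at f (real i / Suc k) + e / 2"
      using of_rat_dense[of "path_at f (real i / Suc k) - e / 2" "path_at f (real i / Suc k) - e / 4"]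
        of_rat_dense[of "path_at f (real i / Suc k) + e / 4" "path_at f (real i / Suc k) + e / 2"] L(3)
      by force
    then show "\<exists>q::rat \<times> rat. path_at f (real i / Suc k) - e / 2 < of_rat (fst q) \<and>
      of_rat (fst q) < path_at f (real i / Suc k) - e / 4 \<and>
      path_at f (real i / Suc k) + e / 4 < of_rat (snd q) \<and>
      of_rat (snd q) < path_at f (real i / Suc k) + e / 2"
      by (intro exI[of _ "(a, b)"]) simp
  qed
  then obtain q :: "nat \<Rightarrow> rat \<times> rat" where q:
    "path_at f (real i / Suc k) - e / 2 < of_rat (fst (q i)) \<and>
      of_rat (fst (q i)) < path_at f (real i / Suc k) - e / 4 \<and>
      path_at f (real i / Suc k) + e / 4 < of_rat (snd (q i)) \<and>
      of_rat (snd (q i)) < path_at f (real i / Suc k) + e / 2" for i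
    by (subst (asm) choice_iff) blast
  define l where "l = map q [0..<T * Suc k]"
  have near: "\<bar>path_at f t - path_at f (real i / Suc k)\<bar> < e / 4"
    if i: "i < T * Suc k" and t: "t \<in> {real i / Suc k..(real i + 1) / Suc k}" for i t
  proof -
    have "real i + 1 = real (Suc i)" by simp
    also have "\<dots> \<le> real (T * Suc k)" using i by (subst of_nat_le_iff) simp
    finally have "(real i + 1) / Suc k \<le> real T" by (simp add: field_simps)
    then have "t \<in> {0..real T}" "real i / Suc k \<in> {0..real T}"
      using t by (auto simp del: of_nat_Suc intro: order_trans[of _ "real i / real (Suc k)"])
    moreover have "dist t (real i / Suc k) < \<delta>"
      using t k by (auto simp: dist_real_def add_divide_distrib simp del: of_nat_Suc)
    ultimately show ?thesis using \<delta>(2) by (simp add: dist_real_def)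
  qed
  have "f \<in> path_box k l"
    unfolding path_box_def
  proof (intro CollectI allI impI ballI)
    fix i t assume "i < length l" and t: "t \<in> {real i / Suc k..(real i + 1) / Suc k}"
    then have i: "i < T * Suc k" "l ! i = q i" by (simp_all add: l_def del: mult_Suc_right)
    show "path_at f t \<in> {of_rat (fst (l ! i))..of_rat (snd (l ! i))}"
      using near[OF i(1) t] q[of i] unfolding i(2) atLeastAtMost_iff by linarith
  qed
  moreover have "path_box k l \<subseteq> U"
  proof
    fix g assume g: "g \<in> path_box k l"
    have "dist (path_at g t) (path_at f t) < e" if "t \<in> L" for t
    proof -
      define i where "i = nat \<lfloor>t * Suc k\<rfloor>"
      have "real i \<le> t * Suc k" "t * Suc k < real i + 1" using T(1)[OF that]
        by (simp_all add: i_def del: of_nat_Suc)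
      then have t: "t \<in> {real i / Suc k..(real i + 1) / Suc k}" by (auto simp: field_simps)
      have "t * Suc k < real (T * Suc k)" using T(2)[OF that] by (simp del: of_nat_Suc mult_Suc_right)
      then have i: "i < T * Suc k"
        using \<open>real i \<le> t * Suc k\<close> by (metis of_nat_less_iff order_le_less_trans)
      then have l: "i < length l" "l ! i = q i" by (simp_all add: l_def del: mult_Suc_right)
      have "path_at g t \<in> {of_rat (fst (q i))..of_rat (snd (q i))}"
        using g t l unfolding path_box_def by force
      then show ?thesis using near[OF i t] q[of i] unfolding dist_real_def atLeastAtMost_iff by linarith
    qed
    then show "g \<in> U" using L(4) by blast
  qed
  ultimately show ?thesis by blast
qed

text \<open>An open set is a countable union of boxes, and by continuity membership in a box is
  tested at rational times only, a countable set of conditions on evaluations.\<close>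

lemma borel_measurable_cpath:
  fixes X :: "'a \<Rightarrow> cpath"
  assumes X[measurable]: "\<And>t. t \<ge> 0 \<Longrightarrow> (\<lambda>\<omega>. path_at (X \<omega>) t) \<in> borel_measurable M"
  shows "X \<in> borel_measurable M"
proof (rule borel_measurableI)
  fix U :: "cpath set" assume U: "open U"
  define I where "I = {(k, l). path_box k l \<subseteq> U}"
  have box: "X -` path_box k l \<inter> space M \<in> sets M" for k l
  proof -
    define Q where "Q i = {r. real_of_rat r \<in> {real i / Suc k..(real i + 1) / Suc k}}" for i
    have Q: "real_of_rat r \<ge> 0" if "r \<in> Q i" for r i
    proof -
      have "0 \<le> real i / Suc k" by simp
      also have "\<dots> \<le> real_of_rat r" using that by (simp add: Q_def del: of_nat_Suc)
      finally show ?thesis .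
    qed
    have "X -` path_box k l \<inter> space M = {\<omega> \<in> space M. \<forall>i\<in>{..<length l}. \<forall>r\<in>Q i.
        path_at (X \<omega>) (of_rat r) \<in> {of_rat (fst (l ! i))..of_rat (snd (l ! i))}}" (is "?A = ?B")
    proof
      show "?A \<subseteq> ?B" by (auto simp: path_box_def Q_def)
      show "?B \<subseteq> ?A"
      proof
        fix \<omega> assume \<omega>: "\<omega> \<in> ?B"
        have "path_at (X \<omega>) t \<in> {of_rat (fst (l ! i))..of_rat (snd (l ! i))}"
          if i: "i < length l" and t: "t \<in> {real i / Suc k..(real i + 1) / Suc k}" for i t
        proof (rule bounds_from_Rats[OF _ _ _ t])
          show "continuous_on {real i / Suc k..(real i + 1) / Suc k} (path_at (X \<omega>))"
            by (intro continuous_on_path_at) (auto intro: order_trans[of _ "real i / real (Suc k)"] simp del: of_nat_Suc)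
          show "real i / Suc k < (real i + 1) / Suc k" by (intro divide_strict_right_mono) auto
          show "path_at (X \<omega>) u \<in> {of_rat (fst (l ! i))..of_rat (snd (l ! i))}"
            if "u \<in> \<rat>" "u \<in> {real i / Suc k..(real i + 1) / Suc k}" for u
          proof -
            obtain r where "u = of_rat r" using \<open>u \<in> \<rat>\<close> by (rule Rats_cases)
            then show ?thesis using that(2) \<omega> i unfolding Q_def by blast
          qed
        qed
        then show "\<omega> \<in> ?A" using \<omega> unfolding path_box_def by blast
      qed
    qed
    also have "?B \<in> sets M"
    proof (rule predE, rule pred_intros_finite(3)[OF finite_lessThan], rule pred_intros_countable_bounded(3))
      fix i r assume "r \<in> Q i"
      note [measurable] = X[OF Q[OF this]]
      show "Measurable.pred M (\<lambda>\<omega>. path_at (X \<omega>) (of_rat r) \<in> {of_rat (fst (l ! i))..of_rat (snd (l ! i))})"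
        by measurable
    qed
    finally show ?thesis .
  qed
  have "U = (\<Union>(k, l)\<in>I. path_box k l)"
    using open_cpath_path_box[OF U] by (auto simp: I_def) blast
  then have "X -` U \<inter> space M = (\<Union>p\<in>I. X -` path_box (fst p) (snd p) \<inter> space M)"
    by (auto simp: case_prod_unfold)
  also have "\<dots> \<in> sets M" using box by (intro sets.countable_UN'') auto
  finally show "X -` U \<inter> space M \<in> sets M" .
qed

section \<open>Tightness\<close>

text \<open>The power 16 is matched to its use with \<open>z = c * q\<^sup>2\<close>: the gain
  \<open>1 / q ^ 32\<close> beats the factor \<open>q ^ 28\<close>, made of \<open>q ^ 16\<close>
  intervals and \<open>q ^ 12\<close> per interval, and leaves \<open>1 / q ^ 4\<close>, which is
  geometric in the level.\<close>

lemma exp_minus_le_inverse_power: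
  fixes z :: real
  assumes "z > 0"
  shows "exp (- z) \<le> (16 / z) ^ 16"
proof -
  have "(z / 16) ^ 16 \<le> (1 + z / 16) ^ 16" using assms by (intro power_mono) auto
  also have "\<dots> \<le> exp z" using exp_ge_one_plus_x_over_n_power_n[of 16 z] assms by simp
  finally show ?thesis using assms by (simp add: exp_minus power_divide field_simps)
qed

text \<open>With \<open>q = \<theta> ^ m\<close> every scale occurring at dyadic level \<open>m\<close> is an integer power of \<open>q\<close>.\<close>

definition \<theta> :: real where "\<theta> = root 16 2"

lemma \<theta>_power: "\<theta> ^ 16 = 2"
  by (simp add: \<theta>_def)

lemma \<theta>_gt_1: "\<theta> > 1"
  by (simp add: \<theta>_def)

text \<open>The constant left over when the exponential is traded for a power of \<open>q\<close>.
  It depends on the horizon alone, not on the sample size; the uniformity required by tightness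
  rests on this.\<close>

definition level_bound :: "nat \<Rightarrow> real" where
  "level_bound T = 16 * (real T)\<^sup>2 * (16 / rate (real T)) ^ 16"

definition (in brownian_family) bad_steps :: "nat \<Rightarrow> nat \<Rightarrow> 'a set" where
  "bad_steps T m = (\<Union>i<T * 2 ^ m. {\<omega> \<in> space M. 2 / \<theta> ^ m < \<bar>X ((real i + 1) / 2 ^ m) \<omega> - X (real i / 2 ^ m) \<omega>\<bar>})"

lemma (in brownian_family) bad_steps_measurable [measurable]: "bad_steps T m \<in> events"
proof -
  have [measurable]: "X ((real i + 1) / 2 ^ m) \<in> borel_measurable M" "X (real i / 2 ^ m) \<in> borel_measurable M" for i
    by auto
  show ?thesis unfolding bad_steps_def by measurable
qed

lemma (in brownian_family) prob_bad_steps_le: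
  assumes m: "m \<ge> 16"
  shows "prob (bad_steps T m) \<le> level_bound T * (1 / \<theta> ^ 4) ^ m"
proof (cases "T = 0")
  case True
  then show ?thesis by (simp add: bad_steps_def level_bound_def)
next
  case False
  define q where "q = \<theta> ^ m"
  define c where "c = rate (real T)"
  have T: "real T \<ge> 1" using False by simp
  have c: "c > 0" using rate_pos[OF T] by (simp add: c_def)
  have q16: "q ^ 16 = 2 ^ m"
    unfolding q_def using \<theta>_power by (metis power_mult mult.commute)
  \<comment> \<open>The restriction \<open>m \<ge> 16\<close> is precisely what gives
    \<open>\<theta> ^ m \<ge> \<theta> ^ 16 = 2\<close>.\<close>
  have q: "q \<ge> 2"
    unfolding q_def using power_increasing[OF m, of \<theta>] \<theta>_gt_1 \<theta>_power by simp
  have [measurable]: "X ((real i + 1) / 2 ^ m) \<in> borel_measurable M" "X (real i / 2 ^ m) \<in> borel_measurable M" for i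
    by auto
  have "prob (bad_steps T m) \<le> (\<Sum>i<T * 2 ^ m. prob {\<omega> \<in> space M. 2 / \<theta> ^ m < \<bar>X ((real i + 1) / 2 ^ m) \<omega> - X (real i / 2 ^ m) \<omega>\<bar>})"
    unfolding bad_steps_def by (intro measure_UNION_le) auto
  also have "\<dots> \<le> (\<Sum>i<T * 2 ^ m. 16 * real T * q ^ 12 * exp (- (c * q\<^sup>2)))"
  proof (intro sum_mono)
    fix i assume i: "i \<in> {..<T * 2 ^ m}"
    have "Suc i \<le> T * 2 ^ m" using i by simp
    then have "real (Suc i) \<le> real (T * 2 ^ m)" by (simp only: of_nat_le_iff)
    then have "real i / 2 ^ m + 1 / q ^ 16 \<le> real T" unfolding q16 by (simp add: field_simps)
    moreover have "real i / 2 ^ m = 0 \<or> 1 / q ^ 16 \<le> real i / 2 ^ m"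
      unfolding q16 by (cases i) (auto intro: divide_right_mono)
    ultimately have "prob {\<omega> \<in> space M. 2 / q < \<bar>X (real i / 2 ^ m + 1 / q ^ 16) \<omega> - X (real i / 2 ^ m) \<omega>\<bar>}
        \<le> 16 * real T * q ^ 12 * exp (- (rate (real T) * q\<^sup>2))"
      by (rule prob_X_step[OF q T])
    then show "prob {\<omega> \<in> space M. 2 / \<theta> ^ m < \<bar>X ((real i + 1) / 2 ^ m) \<omega> - X (real i / 2 ^ m) \<omega>\<bar>}
        \<le> 16 * real T * q ^ 12 * exp (- (c * q\<^sup>2))"
      unfolding q16 by (simp add: add_divide_distrib q_def c_def)
  qed
  also have "\<dots> = 16 * (real T)\<^sup>2 * q ^ 28 * exp (- (c * q\<^sup>2))"
  proof -
    have "q ^ 28 = 2 ^ m * q ^ 12" by (simp flip: q16 power_add)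
    then show ?thesis by (simp add: power2_eq_square)
  qed
  also have "\<dots> \<le> 16 * (real T)\<^sup>2 * q ^ 28 * (16 / (c * q\<^sup>2)) ^ 16"
    using c q by (intro mult_left_mono exp_minus_le_inverse_power) auto
  also have "\<dots> = level_bound T * (1 / q ^ 4)"
  proof -
    have q4: "1 / q ^ 4 = q ^ 28 * (1 / q ^ 32)" using q by (simp add: field_simps flip: power_add)
    have q32: "(16 / (c * q\<^sup>2)) ^ 16 = (16 / c) ^ 16 * (1 / q ^ 32)"
      by (simp add: power_divide power_mult_distrib flip: power_mult)
    show ?thesis unfolding level_bound_def c_def[symmetric] q4 q32 by (simp only: mult_ac)
  qed
  also have "1 / q ^ 4 = (1 / \<theta> ^ 4) ^ m"
    by (simp add: q_def power_one_over mult.commute flip: power_mult)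
  finally show ?thesis .
qed

lemma summable_level: "summable (\<lambda>m. level_bound T * (1 / \<theta> ^ 4) ^ m)"
  using \<theta>_gt_1 one_less_power[of \<theta> 4] by (intro summable_mult summable_geometric) auto

lemma brownian_family_of_independent:
  assumes M: "prob_space M"
    and B: "\<And>j. j \<ge> 1 \<Longrightarrow> standard_brownian_motion M (B j)"
    and ind: "independent_processes M {1..} B"
  shows "brownian_family M B k"
proof -
  interpret prob_space M by fact
  show ?thesis
  proof unfold_locales
    fix j assume "j \<in> {1..2 * k + 1}"
    then have Bj: "standard_brownian_motion M (B j)" using B by simp
    then show "AE \<omega> in M. B j 0 \<omega> = 0" by (simp add: standard_brownian_motion_def)
    show "distributed M lborel (\<lambda>\<omega>. B j t \<omega> - B j s \<omega>) (normal_density 0 (sqrt (t - s)))"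
      if "0 \<le> s" "s < t" for s t
      using Bj that unfolding standard_brownian_motion_def by blast
  next
    fix s t :: real assume st: "0 \<le> s" "0 \<le> t"
    have "indep_vars (\<lambda>_. \<Pi>\<^sub>M t\<in>{0..}. borel) (\<lambda>j \<omega>. \<lambda>t\<in>{0..}. B j t \<omega>) {1..2 * k + 1}"
      by (rule indep_vars_subset[OF ind[unfolded independent_processes_def]]) auto
    then have "indep_vars (\<lambda>_. borel \<Otimes>\<^sub>M borel)
        (\<lambda>j \<omega>. ((\<lambda>t\<in>{0..}. B j t \<omega>) s, (\<lambda>t\<in>{0..}. B j t \<omega>) t)) {1..2 * k + 1}"
      by (rule indep_vars_compose2[where Y = "\<lambda>_ f. (f s, f t)"])
        (use st in \<open>auto intro!: measurable_Pair measurable_component_singleton\<close>)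
    then show "indep_vars (\<lambda>_. borel \<Otimes>\<^sub>M borel) (\<lambda>j \<omega>. (B j s \<omega>, B j t \<omega>)) {1..2 * k + 1}"
      using st by simp
  qed
qed

theorem theorem2p6:
  fixes M :: "'a measure" and B :: "nat \<Rightarrow> real \<Rightarrow> 'a \<Rightarrow> real"
  assumes "prob_space M"
    and "\<And>j. j \<ge> 1 \<Longrightarrow> standard_brownian_motion M (B j)"
    and "independent_processes M {1..} B"
  shows "tight_random_variables M {1..} (\<lambda>n::nat. scaled_median_process B (2 * n + 1))"
proof -
  interpret prob_space M by fact
  let ?Y = "\<lambda>k. scaled_median_process B (2 * k + 1)"
  note fam = brownian_family_of_independent[OF assms]
  have path: "path_at (?Y k \<omega>) t = brownian_family.X B k t \<omega>"
    if "\<omega> \<in> space M" "t \<ge> 0" for k \<omega> t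
  proof -
    interpret brownian_family M B k by (rule fam)
    have cont: "continuous_on {0..} (\<lambda>t. B j t \<omega>)" if "j \<in> {1..2 * k + 1}" for j
      using assms(2)[of j] that \<open>\<omega> \<in> space M\<close> by (simp add: standard_brownian_motion_def)
    have "path_at (?Y k \<omega>) t = sqrt (real n) * median_process B n t \<omega>"
      by (rule path_at_scaled_median_process[where B = B]) (use cont \<open>t \<ge> 0\<close> in auto)
    then show ?thesis by (simp only: X_def med_def median_process_def)
  qed
  have Y[measurable]: "?Y k \<in> borel_measurable M" for k
  proof (rule borel_measurable_cpath)
    fix t :: real assume t: "t \<ge> 0"
    interpret brownian_family M B k by (rule fam)
    show "(\<lambda>\<omega>. path_at (?Y k \<omega>) t) \<in> borel_measurable M"
      using X_measurable[OF t] by (rule measurable_cong[THEN iffD2, rotated]) (simp only: path[OF _ t])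
  qed
  have "\<exists>K. compact K \<and> (\<forall>k\<in>{1..}. measure (distr M borel (?Y k)) K > 1 - \<epsilon>)"
    if \<epsilon>: "\<epsilon> > 0" for \<epsilon> :: real
  proof -
    \<comment> \<open>The error budget per horizon sums over all \<open>T\<close>, starting from 0,
      to \<open>\<epsilon> / 2\<close>, which leaves room for the strict inequality.\<close>
    have "\<exists>N\<ge>16. (\<Sum>m. level_bound T * (1 / \<theta> ^ 4) ^ (m + N)) \<le> \<epsilon> / 4 * (1 / 2) ^ T" for T
    proof -
      from suminf_exist_split[OF _ summable_level, of "\<epsilon> / 4 * (1 / 2) ^ T" T] \<epsilon>
      obtain N where N: "\<And>l. l \<ge> N \<Longrightarrow> norm (\<Sum>m. level_bound T * (1 / \<theta> ^ 4) ^ (m + l)) < \<epsilon> / 4 * (1 / 2) ^ T"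
        by auto
      show ?thesis using N[of "max N 16"] by (intro exI[of _ "max N 16"]) simp
    qed
    then obtain N where N: "\<And>T. N T \<ge> 16"
      "\<And>T. (\<Sum>m. level_bound T * (1 / \<theta> ^ 4) ^ (m + N T)) \<le> \<epsilon> / 4 * (1 / 2) ^ T" by metis
    define b where "b m = 2 * (1 / \<theta>) ^ m" for m
    define w where "w m = 2 * (\<Sum>j. b (j + m))" for m
    have b: "summable b" "b m \<ge> 0" for m
      unfolding b_def using \<theta>_gt_1 by (auto intro!: summable_mult summable_geometric)
    have w: "w \<longlonglongrightarrow> 0"
    proof (rule LIMSEQ_I)
      fix r :: real assume "r > 0"
      then obtain m0 where "\<And>m. m \<ge> m0 \<Longrightarrow> norm (\<Sum>j. b (j + m)) < r / 2"
        using suminf_exist_split[OF _ b(1), of "r / 2"] by auto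
      then show "\<exists>m0. \<forall>m\<ge>m0. norm (w m - 0) < r" by (force simp: w_def)
    qed
    \<comment> \<open>Neither \<open>N\<close> nor \<open>w\<close> refers to \<open>k\<close>, so
      this one set serves all processes.\<close>
    define K where "K = {f. path_at f 0 = 0 \<and> (\<forall>T. \<forall>m\<ge>N T. \<forall>s\<in>{0..real T}. \<forall>t\<in>{0..real T}.
      \<bar>s - t\<bar> \<le> 1 / 2 ^ m \<longrightarrow> \<bar>path_at f s - path_at f t\<bar> \<le> w m)}"
    have K: "compact K" unfolding K_def by (rule compact_cpath_modulus[OF _ w]) simp
    then have [measurable]: "K \<in> sets borel" by (intro borel_closed compact_imp_closed)
    have "1 - \<epsilon> < measure (distr M borel (?Y k)) K" for k
    proof -
      interpret brownian_family M B k by (rule fam)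
      define G where "G = {\<omega> \<in> space M. ?Y k \<omega> \<in> K}"
      have [measurable]: "G \<in> events" unfolding G_def by measurable
      define E where "E T = (\<Union>m. bad_steps T (m + N T))" for T
      have [measurable]: "E T \<in> events" for T unfolding E_def by measurable
      have good: "\<omega> \<in> G" if \<omega>: "\<omega> \<in> space M" "X 0 \<omega> = 0" "\<omega> \<notin> (\<Union>T. E T)" for \<omega>
      proof -
        have "\<bar>path_at (?Y k \<omega>) s - path_at (?Y k \<omega>) t\<bar> \<le> w m"
          if m: "m \<ge> N T" and st: "s \<in> {0..real T}" "t \<in> {0..real T}" "\<bar>s - t\<bar> \<le> 1 / 2 ^ m" for T m s t
          unfolding w_def
        proof (rule dyadic_chaining[OF _ _ b m st])
          show "continuous_on {0..real T} (path_at (?Y k \<omega>))"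
            by (intro continuous_on_path_at) auto
          fix m i assume m: "N T \<le> m" and i: "i < T * 2 ^ m"
          obtain l where "m = l + N T" using m by (metis le_iff_add add.commute)
          then have "\<omega> \<notin> bad_steps T m" using \<omega>(3) by (auto simp: E_def)
          then have "\<bar>X ((real i + 1) / 2 ^ m) \<omega> - X (real i / 2 ^ m) \<omega>\<bar> \<le> 2 / \<theta> ^ m"
            using i \<omega>(1) by (force simp: bad_steps_def)
          then show "\<bar>path_at (?Y k \<omega>) ((real i + 1) / 2 ^ m) - path_at (?Y k \<omega>) (real i / 2 ^ m)\<bar> \<le> b m"
            using path[OF \<omega>(1)] by (simp add: b_def power_one_over)
        qed
        moreover have "path_at (?Y k \<omega>) 0 = 0" using path[OF \<omega>(1)] \<omega>(2) by simp
        ultimately show ?thesis using \<omega>(1) unfolding G_def K_def by blast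
      qed
      have pE: "prob (E T) \<le> \<epsilon> / 4 * (1 / 2) ^ T" for T
      proof -
        have le: "prob (bad_steps T (m + N T)) \<le> level_bound T * (1 / \<theta> ^ 4) ^ (m + N T)" for m
          using N(1)[of T] by (intro prob_bad_steps_le) simp
        have sm: "summable (\<lambda>m. level_bound T * (1 / \<theta> ^ 4) ^ (m + N T))"
          using summable_level by (rule summable_ignore_initial_segment)
        have sp: "summable (\<lambda>m. prob (bad_steps T (m + N T)))"
          using le by (intro summable_comparison_test'[OF sm]) simp
        have "prob (E T) \<le> (\<Sum>m. prob (bad_steps T (m + N T)))"
          unfolding E_def by (intro finite_measure_subadditive_countably sp) auto
        also have "\<dots> \<le> (\<Sum>m. level_bound T * (1 / \<theta> ^ 4) ^ (m + N T))"
          by (intro suminf_le le sp sm)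
        also have "\<dots> \<le> \<epsilon> / 4 * (1 / 2) ^ T" by (rule N)
        finally show ?thesis .
      qed
      have sg: "summable (\<lambda>T. \<epsilon> / 4 * (1 / 2) ^ T)" by (intro summable_mult summable_geometric) simp
      have sE: "summable (\<lambda>T. prob (E T))"
        using pE by (intro summable_comparison_test'[OF sg]) simp
      have "prob (\<Union>T. E T) \<le> (\<Sum>T. prob (E T))"
        by (intro finite_measure_subadditive_countably sE) auto
      also have "\<dots> \<le> (\<Sum>T. \<epsilon> / 4 * (1 / 2) ^ T)" by (intro suminf_le pE sE sg)
      also have "\<dots> = \<epsilon> / 2" by (subst suminf_mult) (auto simp: suminf_geometric summable_geometric)
      finally have small: "prob (\<Union>T. E T) \<le> \<epsilon> / 2" .
      \<comment> \<open>The inclusion holds only up to a null set, because the motions start at 0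
        only almost surely.\<close>
      have "AE \<omega> in M. \<omega> \<in> space M - G \<longrightarrow> \<omega> \<in> (\<Union>T. E T)"
        using med_0 AE_space by eventually_elim (use good in \<open>auto simp: X_def\<close>)
      then have "prob (space M - G) \<le> prob (\<Union>T. E T)"
        by (intro finite_measure_mono_AE) auto
      then have "prob (space M - G) < \<epsilon>" using small \<epsilon> by simp
      then have "1 - \<epsilon> < prob G" by (simp add: prob_compl)
      also have "prob G = measure (distr M borel (?Y k)) K"
        unfolding G_def by (subst measure_distr[OF Y]) (auto intro!: arg_cong[where f = prob])
      finally show ?thesis .
    qed
    then show ?thesis using K by blast
  qed
  then show ?thesis
    unfolding tight_random_variables_def tight_laws_def
    by (intro conjI ballI allI impI Y prob_space_distr) auto
qed

end
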